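(* Let $(X_t)_{t\in\mathbb{Z}}$ be the CM3 process with parameter functions $a_i^{(j)}$ ($i\in\mathbb{Z}_+$, $j\in\mathbb{Z}$), and assume $\sum_{j\in\mathbb{Z}}\sum_{i\geqslant 0}\|a_i^{(j)}\|_\infty<\infty$. Set $a_i^{(j)}=0$ for $i<0$. Then $(X_t)_{t\in\mathbb{Z}}$ is jointly regularly varying with index $\alpha=1$, and its spectral process $(\Theta_t)_{t\in\mathbb{Z}}$ satisfies, for all integers $s,t\geqslant 0$, $$(\Theta_{-s},\ldots,\Theta_t)\overset{d}{=}\left(\frac{a_{-s+I}^{(J)}}{\|a_I^{(J)}\|_\infty},\ldots,\frac{a_{t+I}^{(J)}}{\|a_I^{(J)}\|_\infty}\right),$$ where $(I,J)$ is a random vector on $\mathbb{Z}_+\times\mathbb{Z}$ with distribution $$P[(I,J)=(i,j)]=\frac{\|a_i^{(j)}\|_\infty}{\sum_{l\in\mathbb{Z}}\sum_{k\geqslant 0}\|a_k^{(l)}\|_\infty},\qquad i\in\mathbb{Z}_+,\ j\in\mathbb{Z}.$$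
   Context: Fix an integer $q\geqslant 1$. $\mathbb{Z}_+=\{0,1,2,\ldots\}$, $\mathbb{R}_+=[0,\infty)$. For $f:[0,1]^q\to\mathbb{R}$, $\|f\|_\infty=\sup_{x\in[0,1]^q}|f(x)|$. A unit-Fréchet random variable $Z$ satisfies $P(Z\leqslant z)=\exp(-1/z)$ for $z>0$. CM3 process: let $a_i^{(j)}:[0,1]^q\to(0,\infty)$ ($i\in\mathbb{Z}_+$, $j\in\mathbb{Z}$) be deterministic, strictly positive, continuous functions (the parameter functions) and let $Z_i^{(j)}$ ($i\in\mathbb{Z}$, $j\in\mathbb{Z}$) be independent unit-Fréchet random variables. The CM3 process is $X_t(x)=\sup_{j\in\mathbb{Z}}\sup_{i\geqslant0}(a_i^{(j)}(x)Z_{t-i}^{(j)})$, $x\in[0,1]^q$, $t\in\mathbb{Z}$. Under the summability assumption of the claim, $(X_t)_{t\in\mathbb{Z}}$ is a stationary process of random elements (up to null events) in $\mathcal{C}([0,1]^q,\mathbb{R}_+)$, the space of continuous functions $[0,1]^q\to\mathbb{R}_+$ with the sup-norm metric. Regular variation: a random element $X$ of a separable Banach space $B$ is regularly varying with index $\alpha>0$ if there exist a function $V:(0,\infty)\to(0,\infty)$ regularly varying at infinity with index $-\alpha$ and a nonzero Borel measure $\mu$ on $B\setminus\{0\}$, finite on Borel sets bounded away from $0$, such that $V(u)^{-1}E[f(X/u)]\to\int f\,d\mu$ as $u\to\infty$ for every bounded continuous $f:B\to\mathbb{R}$ vanishing on a neighbourhood of $0$. A stationary process $(X_t)_{t\in\mathbb{Z}}$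 in $B$ is jointly regularly varying with index $\alpha$ if for all integers $k\leqslant l$ the vector $(X_k,\ldots,X_l)$ is regularly varying with index $\alpha$ in $B^{l-k+1}$ (with the maximum norm). Here $B=\mathcal{C}([0,1]^q,\mathbb{R})$ with the sup-norm. Spectral process: the process $(\Theta_t)_{t\in\mathbb{Z}}$ in $\mathcal{C}([0,1]^q,\mathbb{R}_+)$ whose law is the limit in distribution, as $x\to\infty$, of the conditional law of $(X_t/\|X_0\|_\infty)_{t\in\mathbb{Z}}$ given $\|X_0\|_\infty\geqslant x$; that is, for all integers $s,t\geqslant0$, the conditional law of $(X_{-s}/\|X_0\|_\infty,\ldots,X_t/\|X_0\|_\infty)$ given $\|X_0\|_\infty\geqslant x$ converges weakly, as $x\to\infty$, to the law of $(\Theta_{-s},\ldots,\Theta_t)$ in the product space. *)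

theory Defs
  imports "HOL-Probability.Probability"
begin

section \<open>The space of continuous functions on the unit cube\<close>

text \<open>
  The cube is made a type of its own, with the Euclidean metric, so that the continuous
  real functions on it form the type \<open>('q cube, real) bcontfun\<close> of the library, whose norm is the
  supremum norm. Boundedness is no restriction, the cube being compact. The dimension \<open>q\<close> is the
  cardinality of the (nonempty) finite index type \<open>'q\<close>.
\<close>

typedef (overloaded) 'q cube = "{x :: real ^ 'q::finite. \<forall>k. 0 \<le> x $ k \<and> x $ k \<le> 1}"
  morphisms cube_coords Abs_cube
  by (rule exI[of _ 0]) simp

instantiation cube :: (finite) metric_space
begin

definition dist_cube :: "'a cube \<Rightarrow> 'a cube \<Rightarrow> real"
  where "dist_cube x y = dist (cube_coords x) (cube_coords y)"

definition uniformity_cube :: "('a cube \<times> 'a cube) filter"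
  where "uniformity_cube = (INF e\<in>{0<..}. principal {(x, y). dist x y < e})"

definition open_cube :: "'a cube set \<Rightarrow> bool"
  where "open_cube U \<longleftrightarrow> (\<forall>x\<in>U. \<forall>\<^sub>F (x', y) in uniformity. x' = x \<longrightarrow> y \<in> U)"

instance
proof
  show "dist x y = 0 \<longleftrightarrow> x = y" for x y :: "'a cube"
    by (simp add: dist_cube_def cube_coords_inject)
  show "dist x y \<le> dist x z + dist y z" for x y z :: "'a cube"
    unfolding dist_cube_def by (rule dist_triangle2)
qed (simp_all add: uniformity_cube_def open_cube_def)

end

lemma compact_UNIV_cube: "compact (UNIV :: 'q::finite cube set)"
proof -
  let ?C = "{x :: real ^ 'q. \<forall>k. 0 \<le> x $ k \<and> x $ k \<le> 1}"
  have "?C = cbox 0 1"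
    by (auto simp: mem_box_cart)
  then have C: "compact ?C"
    using compact_cbox by metis
  have "continuous_on ?C Abs_cube"
    unfolding continuous_on_iff dist_cube_def by (auto simp: Abs_cube_inverse)
  then have "compact (Abs_cube ` ?C)"
    using C by (rule compact_continuous_image)
  moreover have "Abs_cube ` ?C = UNIV"
    using type_definition.Abs_image[OF type_definition_cube] .
  ultimately show ?thesis
    by simp
qed

lemma continuous_on_cube_iff_bcontfun:
  fixes f :: "'q::finite cube \<Rightarrow> real"
  shows "continuous_on UNIV f \<longleftrightarrow> f \<in> bcontfun"
  unfolding bcontfun_def
  using compact_continuous_image[OF _ compact_UNIV_cube] compact_imp_bounded by blast

instance bcontfun :: (metric_space, banach) banach ..

type_synonym 'q cfun = "('q cube, real) bcontfun"


section \<open>Finite vectors in a Banach space\<close>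

text \<open>
  A vector in the power of \<open>'b\<close> with finite index set \<open>I\<close> is a function in
  \<open>PiE I (\<lambda>_. UNIV)\<close>. The product topology is the topology of the maximum norm.
\<close>

definition vec_top :: "'i set \<Rightarrow> ('i \<Rightarrow> 'b::topological_space) topology"
  where "vec_top I = product_topology (\<lambda>_. euclidean) I"

definition vec_borel :: "'i set \<Rightarrow> ('i \<Rightarrow> 'b::topological_space) measure"
  where "vec_borel I = sigma (topspace (vec_top I)) {U. openin (vec_top I) U}"

definition max_norm :: "'i set \<Rightarrow> ('i \<Rightarrow> 'b::real_normed_vector) \<Rightarrow> real"
  where "max_norm I v = Max ((\<lambda>i. norm (v i)) ` I)"

definition vec_zero :: "'i set \<Rightarrow> 'i \<Rightarrow> 'b::zero"
  where "vec_zero I = (\<lambda>i\<in>I. 0)"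

definition vec_of :: "'i set \<Rightarrow> ('i \<Rightarrow> 'w \<Rightarrow> 'b) \<Rightarrow> 'w \<Rightarrow> 'i \<Rightarrow> 'b"
  where "vec_of I X \<omega> = (\<lambda>i\<in>I. X i \<omega>)"

definition vec_law :: "'w measure \<Rightarrow> 'i set \<Rightarrow> ('i \<Rightarrow> 'w \<Rightarrow> 'b::topological_space) \<Rightarrow> ('i \<Rightarrow> 'b) measure"
  where "vec_law M I X = distr M (vec_borel I) (vec_of I X)"

definition bounded_continuous :: "'i set \<Rightarrow> (('i \<Rightarrow> 'b::topological_space) \<Rightarrow> real) \<Rightarrow> bool"
  where "bounded_continuous I f \<longleftrightarrow>
    continuous_map (vec_top I) euclideanreal f \<and> (\<exists>C. \<forall>v\<in>topspace (vec_top I). \<bar>f v\<bar> \<le> C)"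


section \<open>Regular variation\<close>

definition regularly_varying_fun :: "(real \<Rightarrow> real) \<Rightarrow> real \<Rightarrow> bool"
  where "regularly_varying_fun V \<rho> \<longleftrightarrow>
    V \<in> borel_measurable (restrict_space borel {0<..}) \<and>
    (\<forall>u>0. V u > 0) \<and>
    (\<forall>c>0. ((\<lambda>u. V (c * u) / V u) \<longlongrightarrow> c powr \<rho>) at_top)"

definition regularly_varying_vec ::
    "'w measure \<Rightarrow> 'i set \<Rightarrow> ('i \<Rightarrow> 'w \<Rightarrow> 'b::banach) \<Rightarrow> real \<Rightarrow> bool"
  where "regularly_varying_vec M I X \<alpha> \<longleftrightarrow>
    \<alpha> > 0 \<and>
    vec_of I X \<in> measurable M (vec_borel I) \<and>
    (\<exists>V \<mu>. regularly_varying_fun V (- \<alpha>) \<and>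
      sets \<mu> = sets (restrict_space (vec_borel I) (- {vec_zero I})) \<and>
      emeasure \<mu> (space \<mu>) \<noteq> 0 \<and>
      (\<forall>A\<in>sets \<mu>. (\<exists>\<epsilon>>0. \<forall>v\<in>A. \<epsilon> \<le> max_norm I v) \<longrightarrow> emeasure \<mu> A < \<infinity>) \<and>
      (\<forall>f. bounded_continuous I f \<longrightarrow>
        (\<exists>\<epsilon>>0. \<forall>v\<in>topspace (vec_top I). max_norm I v < \<epsilon> \<longrightarrow> f v = 0) \<longrightarrow>
        ((\<lambda>u. (\<integral>\<omega>. f (vec_of I (\<lambda>i \<omega>. X i \<omega> /\<^sub>R u) \<omega>) \<partial>M) / V u) \<longlongrightarrow> (\<integral>v. f v \<partial>\<mu>)) at_top))"

definition stationary_process :: "'w measure \<Rightarrow> (int \<Rightarrow> 'w \<Rightarrow> 'b::banach) \<Rightarrow> bool"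
  where "stationary_process M X \<longleftrightarrow>
    (\<forall>t. X t \<in> borel_measurable M) \<and>
    (\<forall>k l h. k \<le> l \<longrightarrow> vec_law M {k..l} (\<lambda>t. X (t + h)) = vec_law M {k..l} X)"

definition jointly_regularly_varying ::
    "'w measure \<Rightarrow> (int \<Rightarrow> 'w \<Rightarrow> 'b::banach) \<Rightarrow> real \<Rightarrow> bool"
  where "jointly_regularly_varying M X \<alpha> \<longleftrightarrow>
    stationary_process M X \<and> (\<forall>k l. k \<le> l \<longrightarrow> regularly_varying_vec M {k..l} X \<alpha>)"


section \<open>The spectral process\<close>

definition weakly_converges ::
    "'i set \<Rightarrow> (real \<Rightarrow> ('i \<Rightarrow> 'b::topological_space) measure) \<Rightarrow> ('i \<Rightarrow> 'b) measure \<Rightarrow> bool"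
  where "weakly_converges I \<nu> \<nu>' \<longleftrightarrow>
    (\<forall>f. bounded_continuous I f \<longrightarrow> ((\<lambda>x. \<integral>v. f v \<partial>\<nu> x) \<longlongrightarrow> (\<integral>v. f v \<partial>\<nu>')) at_top)"

definition spectral_process ::
    "'w measure \<Rightarrow> (int \<Rightarrow> 'w \<Rightarrow> 'q::finite cfun) \<Rightarrow> 'v measure \<Rightarrow> (int \<Rightarrow> 'v \<Rightarrow> 'q cfun) \<Rightarrow> bool"
  where "spectral_process M X N \<Theta> \<longleftrightarrow>
    prob_space N \<and>
    (\<forall>t. \<Theta> t \<in> borel_measurable N) \<and>
    (\<forall>t. AE \<omega> in N. \<forall>y. 0 \<le> apply_bcontfun (\<Theta> t \<omega>) y) \<and>
    (\<forall>s t. 0 \<le> s \<longrightarrow> 0 \<le> t \<longrightarrow>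
      weakly_converges {-s..t}
        (\<lambda>x. vec_law (uniform_measure M {\<omega> \<in> space M. norm (X 0 \<omega>) \<ge> x}) {-s..t}
               (\<lambda>i \<omega>. X i \<omega> /\<^sub>R norm (X 0 \<omega>)))
        (vec_law N {-s..t} \<Theta>))"


section \<open>The CM3 process\<close>

definition unit_frechet :: "'w measure \<Rightarrow> ('w \<Rightarrow> real) \<Rightarrow> bool"
  where "unit_frechet M Z \<longleftrightarrow>
    Z \<in> borel_measurable M \<and>
    (\<forall>z>0. measure M {\<omega> \<in> space M. Z \<omega> \<le> z} = exp (- 1 / z))"

text \<open>
  \<open>a i j\<close> stands for \<open>a\<^sub>i\<^sup>(\<^sup>j\<^sup>)\<close> and \<open>Z i j\<close> for \<open>Z\<^sub>i\<^sup>(\<^sup>j\<^sup>)\<close>. The supremum is taken in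
  the extended reals, as it can be infinite on a null event.
\<close>

definition cm3_sup ::
    "(nat \<Rightarrow> int \<Rightarrow> 'q::finite cfun) \<Rightarrow> (int \<Rightarrow> int \<Rightarrow> 'w \<Rightarrow> real) \<Rightarrow> int \<Rightarrow> 'w \<Rightarrow> 'q cube \<Rightarrow> ereal"
  where "cm3_sup a Z t \<omega> y =
    (SUP j::int. SUP i::nat. ereal (apply_bcontfun (a i j) y * Z (t - int i) j \<omega>))"

text \<open>
  The random element \<open>X\<^sub>t\<close> is the above supremum wherever that is a finite continuous function,
  and is set to \<open>0\<close> on the remaining (null) event.
\<close>

definition cm3 ::
    "(nat \<Rightarrow> int \<Rightarrow> 'q::finite cfun) \<Rightarrow> (int \<Rightarrow> int \<Rightarrow> 'w \<Rightarrow> real) \<Rightarrow> int \<Rightarrow> 'w \<Rightarrow> 'q cfun"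
  where "cm3 a Z t \<omega> =
    (if \<exists>g. \<forall>y. ereal (apply_bcontfun g y) = cm3_sup a Z t \<omega> y
     then THE g. \<forall>y. ereal (apply_bcontfun g y) = cm3_sup a Z t \<omega> y
     else 0)"

definition extend_zero :: "(nat \<Rightarrow> int \<Rightarrow> 'b::zero) \<Rightarrow> int \<Rightarrow> int \<Rightarrow> 'b"
  where "extend_zero a i j = (if i < 0 then 0 else a (nat i) j)"

end

theory Submission
  imports Defs
begin

text \<open>
  The proof is the principle of a single big jump. Put \<open>c\<^sub>n(t) = a\<^bsub>t-m\<^esub>\<^sup>(\<^sup>j\<^sup>)\<close> for \<open>n = (m, j)\<close>, so that the path
  of the process is \<open>X\<^sub>t = \<Or>\<^sub>n c\<^sub>n(t) Z\<^sub>n\<close> with one independent unit Frechet innovation \<open>Z\<^sub>n\<close> for each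
  of the countably many indices \<open>n\<close>. As \<open>P (Z\<^sub>n > u)\<close> is about \<open>1/u\<close>, two of the terms \<open>\<parallel>c\<^sub>n(t)\<parallel> Z\<^sub>n\<close> exceed a
  multiple of \<open>u\<close> with probability \<open>O (u\<^sup>-\<^sup>2)\<close> only; this uses that the norms are summable. So, for a functional
  \<open>g\<close> vanishing near zero, \<open>u E g (X/u)\<close> is asymptotically the sum over \<open>n\<close> of the contributions of the
  event that \<open>Z\<^sub>n\<close> alone is large (\<open>sum_over_rare_events\<close>).

  In the \<open>n\<close>-th contribution, \<open>Z\<^sub>n\<close> is replaced by an independent copy \<open>u r\<close>, on the scale of \<open>u\<close>. The law of
  \<open>r\<close>, multiplied by \<open>u\<close>, tends to \<open>r\<^sup>-\<^sup>2 dr\<close> (\<open>frechet_law_scaling\<close>), and the path \<open>X/u\<close> tends to \<open>r c\<^sub>n\<close>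
  because the other innovations stay bounded (\<open>max_linear_fun_upd_near\<close>). Dominated convergence gives
  \<open>u E g (X/u) \<longrightarrow> \<Sum>\<^sub>n \<integral> g (r c\<^sub>n) r\<^sup>-\<^sup>2 dr\<close> for every bounded \<open>g\<close> vanishing near zero that is continuous at almost
  all points of the rays \<open>r c\<^sub>n\<close> (\<open>single_jump_limit\<close> and \<open>max_linear_process_tail\<close>).

  Both claims are instances of this limit. For continuous \<open>g\<close> it is regular variation with index \<open>1\<close>,
  the limit measure being carried by the rays. For \<open>g v = f (v/\<parallel>v\<^sub>0\<parallel>) 1{\<parallel>v\<^sub>0\<parallel> \<ge> 1}\<close> it yields
  \<open>\<Sum>\<^sub>n \<parallel>c\<^sub>n(0)\<parallel> f (c\<^sub>n/\<parallel>c\<^sub>n(0)\<parallel>)\<close>; division by the same expression with \<open>f = 1\<close> is the conditional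
  expectation of \<open>f\<close> in the limit, and the weights are those of the random index \<open>(-I, J)\<close>.

  The measurability of the process rests on two facts: the space of continuous functions on the cube is
  separable, and a supremum of continuous functions that is itself continuous is a uniform limit of the
  partial maxima (\<open>max_linear_iff_LIMSEQ\<close>). The law of the spectral process is unique since bounded
  continuous functions determine a law on a metric space.
\<close>

section \<open>Separability of spaces of continuous functions\<close>

text \<open>Compact metric spaces, of which the cube is one, are the natural domain for the arguments below.\<close>

class compact_metric_space = metric_space +
  assumes compact_UNIV_metric: "compact (UNIV :: 'a set)"

instance cube :: (finite) compact_metric_space
  by standard (rule compact_UNIV_cube)

lemma second_countable_if_countable_dense:
  fixes D :: "'a::metric_space set"
  assumes "countable D" and dense: "\<And>x e. e > 0 \<Longrightarrow> \<exists>d\<in>D. dist x d < e"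
  shows "\<exists>B::'a set set. countable B \<and> open = generate_topology B"
proof -
  let ?B = "(\<lambda>(d, n). ball d (inverse (real (Suc n)))) ` (D \<times> UNIV)"
  have "topological_basis ?B"
  proof (rule topological_basisI)
    show "open U" if "U \<in> ?B" for U
      using that by auto
    fix U and x :: 'a
    assume "open U" "x \<in> U"
    then obtain e where e: "e > 0" "ball x e \<subseteq> U"
      using open_contains_ball by blast
    then obtain n where n: "inverse (real (Suc n)) < e / 2"
      using reals_Archimedean[of "e / 2"] by auto
    obtain d where d: "d \<in> D" "dist x d < inverse (real (Suc n))"
      using dense[of "inverse (real (Suc n))" x] by auto
    have "ball d (inverse (real (Suc n))) \<subseteq> ball x e"
    proof
      fix y assume "y \<in> ball d (inverse (real (Suc n)))"
      then have "dist x y < inverse (real (Suc n)) + inverse (real (Suc n))"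
        using d dist_triangle[of x y d] by (auto intro: order.strict_trans1)
      with n show "y \<in> ball x e" by auto
    qed
    moreover have "x \<in> ball d (inverse (real (Suc n)))"
      using d by (simp add: dist_commute)
    ultimately show "\<exists>V\<in>?B. x \<in> V \<and> V \<subseteq> U"
      using d e by (intro bexI[of _ "ball d (inverse (real (Suc n)))"]) (auto intro!: image_eqI[of _ _ "(d, n)"])
  qed
  moreover have "countable ?B"
    using assms(1) by auto
  ultimately show ?thesis
    using topological_basis_imp_subbasis by blast
qed

text \<open>
  A continuous function on a compact space is determined, up to \<open>4/k\<close>, by a modulus of
  continuity \<open>1/m\<close> for the accuracy \<open>1/k\<close> and by approximate values on a finite \<open>1/m\<close>-net.
  With the approximate values taken from a countable dense set, these data are countable in number.
\<close>

lemma countable_dense_bcontfun: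
  "\<exists>D :: ('a::compact_metric_space \<Rightarrow>\<^sub>C 'b::{metric_space, second_countable_topology}) set.
     countable D \<and> (\<forall>f. \<forall>e>0. \<exists>g\<in>D. dist f g < e)"
proof -
  obtain D :: "'b set" where D: "countable D" "\<And>U. open U \<Longrightarrow> U \<noteq> {} \<Longrightarrow> \<exists>d\<in>D. d \<in> U"
    using countable_dense_setE by blast
  define r where "r m = inverse (real (Suc m))" for m
  have r: "r m > 0" for m by (simp add: r_def)
  have "\<exists>F :: 'a set. finite F \<and> (\<forall>y. \<exists>x\<in>F. dist x y < r m)" for m
  proof -
    have "\<exists>F. finite F \<and> F \<subseteq> (UNIV::'a set) \<and> UNIV \<subseteq> (\<Union>x\<in>F. ball x (r m))"
      by (rule compactE_image[OF compact_UNIV_metric, of UNIV "\<lambda>x. ball x (r m)"])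
        (auto simp: r)
    then show ?thesis by (force simp: subset_eq)
  qed
  then obtain F :: "nat \<Rightarrow> 'a set" where F: "\<And>m. finite (F m)" "\<And>m y. \<exists>x\<in>F m. dist x y < r m"
    by metis
  define G :: "nat \<Rightarrow> nat \<Rightarrow> ('a \<Rightarrow>\<^sub>C 'b) set"
    where "G m k = {f. \<forall>x y. dist x y < r m \<longrightarrow> dist (apply_bcontfun f x) (apply_bcontfun f y) < r k}" for m k
  define fits where "fits m k \<phi> f \<longleftrightarrow> f \<in> G m k \<and> (\<forall>x\<in>F m. dist (apply_bcontfun f x) (\<phi> x) < r k)"
    for m k \<phi> f
  let ?D = "(\<lambda>(m, k, \<phi>). SOME f. fits m k \<phi> f) ` (SIGMA m:UNIV. SIGMA k:UNIV. PiE (F m) (\<lambda>_. D))"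
  have "countable ?D"
    by (intro countable_image countable_SIGMA countable_PiE F D(1)) auto
  moreover have "\<exists>g\<in>?D. dist f g < e" if e: "e > 0" for f e
  proof -
    obtain k where k: "r k < e / 5"
      using reals_Archimedean[of "e / 5"] e by (auto simp: r_def)
    have "uniformly_continuous_on UNIV (apply_bcontfun f)"
      using compact_uniformly_continuous[OF _ compact_UNIV_metric] by auto
    then obtain d where d: "d > 0" "\<And>x y. dist x y < d \<Longrightarrow> dist (apply_bcontfun f x) (apply_bcontfun f y) < r k"
      using r[of k] unfolding uniformly_continuous_on_def by (metis UNIV_I dist_commute)
    obtain m where m: "r m < d"
      using reals_Archimedean[of d] d by (auto simp: r_def)
    have fG: "f \<in> G m k" using d m by (auto simp: G_def)
    have "\<exists>v\<in>D. dist (apply_bcontfun f x) v < r k" for x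
      using D(2)[of "ball (apply_bcontfun f x) (r k)"] r[of k] by auto
    then obtain \<psi> where \<psi>: "\<And>x. \<psi> x \<in> D" "\<And>x. dist (apply_bcontfun f x) (\<psi> x) < r k" by metis
    define \<phi> where "\<phi> = restrict \<psi> (F m)"
    have \<phi>: "\<phi> \<in> PiE (F m) (\<lambda>_. D)" using \<psi> by (auto simp: \<phi>_def)
    have ff: "fits m k \<phi> f" using fG \<psi> by (auto simp: fits_def \<phi>_def)
    define g where "g = (SOME f. fits m k \<phi> f)"
    have g: "fits m k \<phi> g" unfolding g_def using ff by (rule someI)
    have "dist (apply_bcontfun f y) (apply_bcontfun g y) \<le> 4 * r k" for y
    proof -
      obtain x where x: "x \<in> F m" "dist x y < r m" using F by blast
      have "dist (f y) (g y) \<le> dist (f x) (f y) + dist (f x) (\<phi> x) + dist (g x) (\<phi> x) + dist (g x) (g y)"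
        by metric
      moreover have "dist (f x) (f y) < r k" "dist (g x) (g y) < r k"
        using fG g x by (auto simp: fits_def G_def)
      moreover have "dist (f x) (\<phi> x) < r k" "dist (g x) (\<phi> x) < r k"
        using ff g x by (auto simp: fits_def)
      ultimately show ?thesis by linarith
    qed
    then have "dist f g \<le> 4 * r k" by (rule dist_bound)
    then have "dist f g < e" using k r[of k] by linarith
    moreover have "g \<in> ?D"
      unfolding g_def using \<phi> by (intro image_eqI[of _ _ "(m, k, \<phi>)"]) auto
    ultimately show ?thesis by blast
  qed
  ultimately show ?thesis by (intro exI[of _ ?D]) blast
qed

text \<open>
  Over a separable space, measurability of a path or a vector can be checked coordinate by coordinate.
\<close>

instance bcontfun :: (compact_metric_space, "{metric_space, second_countable_topology}")
  second_countable_topology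
  by standard (use countable_dense_bcontfun in \<open>meson second_countable_if_countable_dense\<close>)

section \<open>Suprema of countably many continuous functions\<close>

text \<open>A relation rather than a function, as the supremum can be infinite or discontinuous.\<close>

definition max_linear :: "('n \<Rightarrow> ('k::topological_space \<Rightarrow>\<^sub>C real)) \<Rightarrow> ('n \<Rightarrow> real) \<Rightarrow> ('k \<Rightarrow>\<^sub>C real) \<Rightarrow> bool"
  where "max_linear c z g \<longleftrightarrow> (\<forall>y. ereal (g y) = (SUP n. ereal (c n y * z n)))"

definition bcont_max :: "('k::topological_space \<Rightarrow>\<^sub>C real) \<Rightarrow> ('k \<Rightarrow>\<^sub>C real) \<Rightarrow> ('k \<Rightarrow>\<^sub>C real)"
  where "bcont_max f g = Bcontfun (\<lambda>y. max (f y) (g y))"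

lemma apply_bcont_max: "bcont_max f g y = max (f y) (g y)"
proof -
  obtain a b where ab: "\<And>y. \<bar>f y\<bar> \<le> a" "\<And>y. \<bar>g y\<bar> \<le> b"
    using bounded_apply_bcontfun[of f] bounded_apply_bcontfun[of g] by (auto simp: bounded_iff)
  have "\<bar>max (f y) (g y)\<bar> \<le> max a b" for y
    using ab[of y] by linarith
  then have "(\<lambda>y. max (f y) (g y)) \<in> bcontfun"
    by (auto intro!: bcontfun_normI[where b = "max a b"] continuous_intros)
  then show ?thesis by (simp add: bcont_max_def Bcontfun_inverse)
qed

lemma dist_bcont_max:
  "dist (bcont_max f g) (bcont_max f' g') \<le> max (dist f f') (dist g g')"
proof (rule dist_bound)
  fix y
  have "dist (f y) (f' y) \<le> dist f f'" "dist (g y) (g' y) \<le> dist g g'"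
    by (rule dist_bounded)+
  then show "dist (bcont_max f g y) (bcont_max f' g' y) \<le> max (dist f f') (dist g g')"
    by (auto simp: apply_bcont_max dist_real_def)
qed

lemma continuous_on_bcont_max:
  "continuous_on UNIV (\<lambda>p :: ('k::topological_space \<Rightarrow>\<^sub>C real) \<times> _. bcont_max (fst p) (snd p))"
  unfolding continuous_on_iff
proof (intro ballI allI impI)
  fix p :: "('k \<Rightarrow>\<^sub>C real) \<times> ('k \<Rightarrow>\<^sub>C real)" and e :: real
  assume "e > 0"
  moreover have "dist (bcont_max (fst q) (snd q)) (bcont_max (fst p) (snd p)) \<le> dist q p" for q
    using dist_bcont_max[of "fst q" "snd q" "fst p" "snd p"] dist_fst_le[of q p] dist_snd_le[of q p]
    by linarith
  ultimately show "\<exists>d>0. \<forall>q\<in>UNIV. dist q p < d \<longrightarrow>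
      dist (bcont_max (fst q) (snd q)) (bcont_max (fst p) (snd p)) < e"
    by (meson le_less_trans)
qed

lemma borel_measurable_bcont_max[measurable]:
  fixes f g :: "'w \<Rightarrow> ('k::compact_metric_space \<Rightarrow>\<^sub>C real)"
  assumes "f \<in> borel_measurable M" "g \<in> borel_measurable M"
  shows "(\<lambda>x. bcont_max (f x) (g x)) \<in> borel_measurable M"
  using borel_measurable_continuous_Pair[OF assms continuous_on_bcont_max] .

primrec partial_max :: "('n::countable \<Rightarrow> ('k::topological_space \<Rightarrow>\<^sub>C real)) \<Rightarrow> ('n \<Rightarrow> real) \<Rightarrow> nat \<Rightarrow> ('k \<Rightarrow>\<^sub>C real)"
  where
    "partial_max c z 0 = z (from_nat 0) *\<^sub>R c (from_nat 0)"
  | "partial_max c z (Suc N) = bcont_max (partial_max c z N) (z (from_nat (Suc N)) *\<^sub>R c (from_nat (Suc N)))"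

lemma partial_max_mono:
  fixes c :: "'n::countable \<Rightarrow> ('k::topological_space \<Rightarrow>\<^sub>C real)"
  shows "M \<le> N \<Longrightarrow> partial_max c z M y \<le> partial_max c z N y"
  by (rule lift_Suc_mono_le[of "\<lambda>N. partial_max c z N y"]) (simp_all add: apply_bcont_max)

lemma term_le_partial_max:
  fixes c :: "'n::countable \<Rightarrow> ('k::topological_space \<Rightarrow>\<^sub>C real)"
  shows "c n y * z n \<le> partial_max c z (to_nat n) y"
  by (cases "to_nat n"; use from_nat_to_nat[of n] in \<open>simp add: apply_bcont_max mult.commute\<close>)

lemma partial_max_attained:
  fixes c :: "'n::countable \<Rightarrow> ('k::topological_space \<Rightarrow>\<^sub>C real)"
  shows "\<exists>n. partial_max c z N y = c n y * z n"
proof (induction N)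
  case 0
  then show ?case by (auto simp: mult.commute intro: exI[of _ "from_nat 0"])
next
  case (Suc N)
  then show ?case
    by (auto simp: apply_bcont_max max_def mult.commute intro: exI[of _ "from_nat (Suc N)"])
qed

lemma SUP_eq_SUP_partial_max:
  fixes c :: "'n::countable \<Rightarrow> ('k::topological_space \<Rightarrow>\<^sub>C real)"
  shows "(SUP n. ereal (c n y * z n)) = (SUP N. ereal (partial_max c z N y))"
proof (rule SUP_eq)
  show "\<exists>N\<in>UNIV. ereal (c n y * z n) \<le> ereal (partial_max c z N y)" for n
    using term_le_partial_max[of c n y z] by auto
  show "\<exists>n\<in>UNIV. ereal (partial_max c z N y) \<le> ereal (c n y * z n)" for N
    using partial_max_attained[of c z N y] by auto
qed

text \<open>
  A supremum that is a finite continuous function is a uniform limit of the partial maxima, by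
  Dini's theorem. This turns the pointwise requirement, which involves uncountably many points,
  into the convergence of a sequence in a separable space: it is the source of all measurability.
\<close>

lemma max_linear_iff_LIMSEQ:
  fixes c :: "'n::countable \<Rightarrow> ('k::compact_metric_space \<Rightarrow>\<^sub>C real)"
  shows "max_linear c z g \<longleftrightarrow> partial_max c z \<longlonglongrightarrow> g"
proof
  assume g: "max_linear c z g"
  have sup: "ereal (g y) = (SUP N. ereal (partial_max c z N y))" for y
    using g by (simp add: max_linear_def SUP_eq_SUP_partial_max)
  have le: "partial_max c z N y \<le> g y" for N y
    by (metis SUP_upper UNIV_I ereal_less_eq(3) sup)
  show "partial_max c z \<longlonglongrightarrow> g"
  proof (rule metric_LIMSEQ_I)
    fix e :: real assume e: "e > 0"
    let ?U = "\<lambda>N. {y. g y - e / 2 < partial_max c z N y}"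
    have "\<exists>N. g y - e / 2 < partial_max c z N y" for y
    proof -
      have "ereal (g y - e / 2) < (SUP N. ereal (partial_max c z N y))"
        using e by (simp flip: sup)
      then show ?thesis by (auto simp: less_SUP_iff)
    qed
    then have "UNIV \<subseteq> (\<Union>N. ?U N)" by auto
    moreover have "open (?U N)" for N
      by (intro open_Collect_less continuous_intros) auto
    ultimately obtain C where C: "finite C" "UNIV \<subseteq> (\<Union>N\<in>C. ?U N)"
      by (meson compactE_image[OF compact_UNIV_metric])
    have "dist (partial_max c z N) g < e" if N: "N \<ge> Max (insert 0 C)" for N
    proof -
      have "dist (partial_max c z N y) (g y) \<le> e / 2" for y
      proof -
        obtain K where K: "K \<in> C" "g y - e / 2 < partial_max c z K y" using C by auto
        then have "K \<le> N" using N C(1) by simp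
        then have "partial_max c z K y \<le> partial_max c z N y" by (rule partial_max_mono)
        then show ?thesis using K le[of N y] by (auto simp: dist_real_def)
      qed
      then have "dist (partial_max c z N) g \<le> e / 2" by (rule dist_bound)
      then show ?thesis using e by simp
    qed
    then show "\<exists>N0. \<forall>N\<ge>N0. dist (partial_max c z N) g < e" by blast
  qed
next
  assume lim: "partial_max c z \<longlonglongrightarrow> g"
  have "(\<lambda>N. partial_max c z N y) \<longlonglongrightarrow> g y" for y
    by (rule tendsto_uniform_limitI[OF tendsto_bcontfun_uniform_limit[OF lim]]) simp
  then have "(\<lambda>N. ereal (partial_max c z N y)) \<longlonglongrightarrow> ereal (g y)" for y
    by simp
  moreover have "(\<lambda>N. ereal (partial_max c z N y)) \<longlonglongrightarrow> (SUP N. ereal (partial_max c z N y))" for y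
    by (rule LIMSEQ_SUP) (auto simp: incseq_def intro: partial_max_mono)
  ultimately have "ereal (g y) = (SUP N. ereal (partial_max c z N y))" for y
    using LIMSEQ_unique by blast
  then show "max_linear c z g"
    by (simp add: max_linear_def SUP_eq_SUP_partial_max)
qed

lemma max_linear_unique: "max_linear c z g \<Longrightarrow> max_linear c z g' \<Longrightarrow> g = g'"
  unfolding max_linear_def by (metis bcontfun_eqI ereal.inject)

text \<open>The default value \<open>0\<close> is the one in the definition of the CM3 process.\<close>

definition max_linear_fun :: "('n \<Rightarrow> ('k::topological_space \<Rightarrow>\<^sub>C real)) \<Rightarrow> ('n \<Rightarrow> real) \<Rightarrow> ('k \<Rightarrow>\<^sub>C real)"
  where "max_linear_fun c z = (if \<exists>g. max_linear c z g then THE g. max_linear c z g else 0)"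

lemma max_linear_fun_eq: "max_linear c z g \<Longrightarrow> max_linear_fun c z = g"
  unfolding max_linear_fun_def using max_linear_unique by (metis the_equality)

lemma measurable_max_linear_fun:
  fixes c :: "'n::countable \<Rightarrow> ('k::compact_metric_space \<Rightarrow>\<^sub>C real)"
  assumes Z[measurable]: "\<And>n. (\<lambda>\<omega>. Z \<omega> n) \<in> borel_measurable M"
  shows "(\<lambda>\<omega>. max_linear_fun c (Z \<omega>)) \<in> borel_measurable M"
proof -
  have [measurable]: "(\<lambda>\<omega>. partial_max c (Z \<omega>) N) \<in> borel_measurable M" for N
    by (induction N) simp_all
  have "max_linear_fun c z =
      (if Cauchy (partial_max c z) then lim (partial_max c z) else 0)" for z
  proof (cases "Cauchy (partial_max c z)")
    case True
    then have "partial_max c z \<longlonglongrightarrow> lim (partial_max c z)"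
      using Cauchy_convergent_iff convergent_LIMSEQ_iff by blast
    then show ?thesis
      using True max_linear_fun_eq max_linear_iff_LIMSEQ by metis
  next
    case False
    then have "\<nexists>g. max_linear c z g"
      by (metis LIMSEQ_imp_Cauchy max_linear_iff_LIMSEQ)
    with False show ?thesis by (simp add: max_linear_fun_def)
  qed
  then show ?thesis by simp
qed

subsection \<open>Existence and bounds\<close>

definition tame :: "('n \<Rightarrow> ('k::topological_space \<Rightarrow>\<^sub>C real)) \<Rightarrow> ('n \<Rightarrow> real) \<Rightarrow> bool"
  where "tame c z \<longleftrightarrow> (\<forall>n. 0 \<le> z n) \<and> (\<forall>e>0. finite {n. e \<le> norm (c n) * z n})"

lemma tame_fun_upd:
  assumes "tame c z" "0 \<le> r"
  shows "tame c (z(n := r))"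
proof -
  have "finite {m. e \<le> norm (c m) * (z(n := r)) m}" if "e > 0" for e
    by (rule finite_subset[of _ "insert n {m. e \<le> norm (c m) * z m}"])
      (use assms that in \<open>auto simp: tame_def\<close>)
  then show ?thesis using assms by (auto simp: tame_def)
qed

lemma apply_le_norm: "apply_bcontfun f y \<le> norm (f :: 'k::topological_space \<Rightarrow>\<^sub>C real)"
  using norm_bounded[of f y] by simp

text \<open>
  As only finitely many terms reach the level \<open>e\<close>, the partial maxima grow by at most \<open>e\<close> once these terms have
  been included. So they form a Cauchy sequence.
\<close>

lemma ex_max_linear:
  fixes c :: "'n::countable \<Rightarrow> ('k::compact_metric_space \<Rightarrow>\<^sub>C real)"
  assumes tame: "tame c z" and c: "\<And>n y. 0 \<le> c n y"
  shows "\<exists>g. max_linear c z g"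
proof -
  have z: "0 \<le> z n" for n using tame by (simp add: tame_def)
  have pos: "0 \<le> partial_max c z N y" for N y
    using partial_max_attained[of c z N y] c z by (metis mult_nonneg_nonneg)
  have "Cauchy (partial_max c z)"
  proof (rule metric_CauchyI)
    fix e :: real assume e: "e > 0"
    have fin: "finite {n. e / 3 \<le> norm (c n) * z n}"
      using tame e unfolding tame_def by (metis divide_pos_pos zero_less_numeral)
    define N0 where "N0 = Max (insert 0 (to_nat ` {n. e / 3 \<le> norm (c n) * z n}))"
    have close: "partial_max c z N y \<le> partial_max c z N0 y + e / 3" for N y
    proof -
      obtain n where n: "partial_max c z N y = c n y * z n"
        using partial_max_attained by blast
      show ?thesis
      proof (cases "e / 3 \<le> norm (c n) * z n")
        case True
        then have "to_nat n \<le> N0" using fin unfolding N0_def by (intro Max_ge) auto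
        then show ?thesis
          using n term_le_partial_max[of c n y z] partial_max_mono[of "to_nat n" N0 c z y] e by linarith
      next
        case False
        have "c n y * z n \<le> norm (c n) * z n"
          by (intro mult_right_mono z apply_le_norm)
        then show ?thesis using False n pos[of N0 y] by linarith
      qed
    qed
    have near: "dist (partial_max c z N) (partial_max c z N0) \<le> e / 3" if "N \<ge> N0" for N
    proof (rule dist_bound)
      fix y
      show "dist (partial_max c z N y) (partial_max c z N0 y) \<le> e / 3"
        using close[of N y] partial_max_mono[OF that, of c z y] by (auto simp: dist_real_def)
    qed
    show "\<exists>N0. \<forall>M\<ge>N0. \<forall>N\<ge>N0. dist (partial_max c z M) (partial_max c z N) < e"
    proof (intro exI allI impI)
      fix M N assume "M \<ge> N0" "N \<ge> N0"
      then show "dist (partial_max c z M) (partial_max c z N) < e"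
        using near[of M] near[of N] e dist_triangle2[of "partial_max c z M" "partial_max c z N" "partial_max c z N0"]
        by linarith
    qed
  qed
  then obtain g where "partial_max c z \<longlonglongrightarrow> g"
    using Cauchy_convergent_iff convergent_def by blast
  then show ?thesis using max_linear_iff_LIMSEQ by blast
qed

lemma max_linear_ge:
  fixes c :: "'n \<Rightarrow> ('k::topological_space \<Rightarrow>\<^sub>C real)"
  shows "max_linear c z g \<Longrightarrow> c n y * z n \<le> g y"
  using SUP_upper[of n UNIV "\<lambda>n. ereal (c n y * z n)"] unfolding max_linear_def by (metis UNIV_I ereal_less_eq(3))

lemma max_linear_le:
  fixes c :: "'n \<Rightarrow> ('k::topological_space \<Rightarrow>\<^sub>C real)"
  assumes "max_linear c z g" "\<And>n. c n y * z n \<le> b"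
  shows "g y \<le> b"
proof -
  have "ereal (g y) \<le> ereal b"
    using assms by (auto simp: max_linear_def intro: SUP_least)
  then show ?thesis by simp
qed

lemma max_linear_norm_le:
  fixes c :: "'n \<Rightarrow> ('k::topological_space \<Rightarrow>\<^sub>C real)"
  assumes g: "max_linear c z g" and c: "\<And>n y. 0 \<le> c n y" and z: "\<And>n. 0 \<le> z n"
    and le: "\<And>n. norm (c n) * z n \<le> b"
  shows "norm g \<le> b"
proof (rule norm_bound)
  fix y
  have "c n y * z n \<le> b" for n
    by (rule order.trans[OF mult_right_mono[OF apply_le_norm z] le])
  then have "g y \<le> b" by (rule max_linear_le[OF g])
  moreover have "0 \<le> g y"
    using max_linear_ge[OF g, of undefined y] c[of undefined y] z[of undefined]
    by (meson mult_nonneg_nonneg order_trans)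
  ultimately show "norm (g y) \<le> b" by simp
qed

text \<open>
  Raising one coordinate \<open>z\<^sub>n\<close> to \<open>r\<close> makes the supremum \<open>r c\<^sub>n\<close>, up to the size of the original
  supremum. This is how a single large innovation dominates the whole process.
\<close>

lemma max_linear_fun_upd_near:
  fixes c :: "'n \<Rightarrow> ('k::topological_space \<Rightarrow>\<^sub>C real)"
  assumes g: "max_linear c z g" and g': "max_linear c (z(n := r)) g'"
    and c: "\<And>n y. 0 \<le> c n y" and z: "\<And>n. 0 \<le> z n" and r: "0 \<le> r"
  shows "norm (g' - r *\<^sub>R c n) \<le> norm g"
proof (rule norm_bound)
  fix y
  have "r * c n y \<le> g' y"
    using max_linear_ge[OF g', of n y] by (simp add: mult.commute)
  moreover have "g' y \<le> r * c n y + g y"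
  proof (rule max_linear_le[OF g'])
    fix m
    have "0 \<le> r * c n y" using c r by simp
    moreover have "0 \<le> g y"
      using max_linear_ge[OF g, of n y] c[of n y] z[of n] by (meson mult_nonneg_nonneg order_trans)
    ultimately show "c m y * (z(n := r)) m \<le> r * c n y + g y"
      using max_linear_ge[OF g, of m y] by (auto simp: mult.commute)
  qed
  ultimately show "norm ((g' - r *\<^sub>R c n) y) \<le> norm g"
    using apply_le_norm[of g y] by simp
qed

section \<open>The unit Frechet law and its tail\<close>

definition frechet_law :: "real measure"
  where "frechet_law = density lborel (\<lambda>r. ennreal (if 0 < r then exp (- 1 / r) / r\<^sup>2 else 0))"

definition tail_measure :: "real measure"
  where "tail_measure = density lborel (\<lambda>r. ennreal (if 0 < r then 1 / r\<^sup>2 else 0))"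

lemma sets_frechet_law[simp, measurable_cong]: "sets frechet_law = sets borel"
  and space_frechet_law[simp]: "space frechet_law = UNIV"
  and sets_tail_measure[simp, measurable_cong]: "sets tail_measure = sets borel"
  and space_tail_measure[simp]: "space tail_measure = UNIV"
  by (simp_all add: frechet_law_def tail_measure_def)

lemma AE_frechet_law_pos: "AE r in frechet_law. 0 < r"
  and AE_tail_measure_pos: "AE r in tail_measure. 0 < r"
  unfolding frechet_law_def tail_measure_def by (subst AE_density; auto)+

lemma emeasure_tail_measure_atLeast:
  assumes "0 < d"
  shows "emeasure tail_measure {d..} = ennreal (1 / d)"
proof -
  have "emeasure tail_measure {d..} = (\<integral>\<^sup>+r. ennreal (1 / r\<^sup>2) * indicator {d..} r \<partial>lborel)"
    unfolding tail_measure_def using assms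
    by (subst emeasure_density) (auto intro!: nn_integral_cong split: split_indicator)
  also have "\<dots> = ennreal (0 - (- 1 / d))"
  proof (rule nn_integral_FTC_atLeast)
    show "((\<lambda>r::real. - 1 / r) has_real_derivative 1 / r\<^sup>2) (at r)" if "d \<le> r" for r
      using that assms by (auto intro!: derivative_eq_intros simp: power2_eq_square)
    show "((\<lambda>r::real. - 1 / r) \<longlongrightarrow> 0) at_top"
      by (intro tendsto_divide_0[OF tendsto_const] filterlim_at_top_imp_at_infinity filterlim_ident)
  qed auto
  finally show ?thesis by simp
qed

lemma tendsto_exp_neg_inverse_at_right_0: "((\<lambda>r::real. exp (- 1 / r)) \<longlongrightarrow> 0) (at_right 0)"
proof -
  have "filterlim (\<lambda>r::real. - inverse r) at_bot (at_right 0)"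
    using filterlim_inverse_at_top_right by (simp add: filterlim_uminus_at_bot)
  from filterlim_compose[OF exp_at_bot this] show ?thesis by (simp add: divide_inverse)
qed

lemma emeasure_frechet_law_atMost:
  "emeasure frechet_law {..a} = ennreal (if 0 < a then exp (- 1 / a) else 0)"
proof (cases "0 < a")
  case False
  then have "emeasure frechet_law {..a} = 0"
    using AE_frechet_law_pos by (subst emeasure_eq_AE[where B="{}"]) (auto elim!: eventually_mono)
  with False show ?thesis by simp
next
  case True
  let ?f = "\<lambda>r::real. exp (- 1 / r) / r\<^sup>2"
  have der: "((\<lambda>r. exp (- 1 / r)) has_real_derivative ?f r) (at r)" if "ereal 0 < ereal r" "ereal r < ereal a" for r
    using that by (auto intro!: derivative_eq_intros simp: power2_eq_square)
  have cont: "isCont ?f r" if "ereal 0 < ereal r" "ereal r < ereal a" for r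
    using that by (auto intro!: continuous_intros)
  have ends: "(((\<lambda>r. exp (- 1 / r)) \<circ> real_of_ereal) \<longlongrightarrow> 0) (at_right (ereal 0))"
    "(((\<lambda>r. exp (- 1 / r)) \<circ> real_of_ereal) \<longlongrightarrow> exp (- 1 / a)) (at_left (ereal a))"
    unfolding ereal_tendsto_simps1 using tendsto_exp_neg_inverse_at_right_0 True by (auto intro!: tendsto_intros)
  have FTC: "set_integrable lborel (einterval (ereal 0) (ereal a)) ?f" "(LBINT r=ereal 0..ereal a. ?f r) = exp (- 1 / a)"
    using interval_integral_FTC_nonneg[OF _ der cont _ ends] True by auto
  have "emeasure frechet_law {..a} = (\<integral>\<^sup>+r. ennreal (indicator {0<..<a} r *\<^sub>R ?f r) \<partial>lborel)"
    unfolding frechet_law_def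
    by (subst emeasure_density, simp_all, intro nn_integral_cong_AE)
      (auto intro!: eventually_mono[OF AE_lborel_singleton[of a]] split: split_indicator)
  also have "\<dots> = ennreal (LBINT r:{0<..<a}. ?f r)"
    unfolding set_lebesgue_integral_def
    by (intro nn_integral_eq_integral) (use FTC(1) in \<open>auto simp: set_integrable_def split: split_indicator\<close>)
  also have "(LBINT r:{0<..<a}. ?f r) = exp (- 1 / a)"
    using FTC(2) True by (simp add: interval_lebesgue_integral_def del: zero_ereal_def)
  finally show ?thesis using True by simp
qed

lemma prob_space_frechet_law: "prob_space frechet_law"
proof
  have "(\<lambda>k. emeasure frechet_law {..real k}) \<longlonglongrightarrow> emeasure frechet_law (\<Union>k. {..real k})"
    by (intro Lim_emeasure_incseq) (auto simp: incseq_def)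
  moreover have "(\<Union>k. {..real k}) = UNIV"
    by (auto intro: real_arch_simple)
  moreover have "(\<lambda>k. emeasure frechet_law {..real k}) \<longlonglongrightarrow> ennreal 1"
  proof -
    have "(\<lambda>k. exp (- 1 / real k)) \<longlonglongrightarrow> exp 0"
      by (intro tendsto_intros tendsto_divide_0[OF tendsto_const] filterlim_at_top_imp_at_infinity
          filterlim_real_sequentially)
    from tendsto_ennrealI[OF this]
    have "(\<lambda>k. ennreal (exp (- 1 / real k))) \<longlonglongrightarrow> ennreal 1" by simp
    then show ?thesis
      by (rule Lim_transform_eventually)
        (auto intro!: eventually_sequentiallyI[of 1] simp: emeasure_frechet_law_atMost)
  qed
  ultimately show "emeasure frechet_law (space frechet_law) = 1"
    using LIMSEQ_unique by force
qed

text \<open>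
  The distribution function is prescribed for positive arguments only; letting them tend to \<open>0\<close> shows
  that there is no mass on the negative half-line.
\<close>

lemma distr_unit_frechet:
  assumes "prob_space M" "unit_frechet M Z"
  shows "distr M borel Z = frechet_law"
proof -
  interpret prob_space M by fact
  have Z[measurable]: "Z \<in> borel_measurable M"
    and cdf: "\<And>z. 0 < z \<Longrightarrow> prob {\<omega> \<in> space M. Z \<omega> \<le> z} = exp (- 1 / z)"
    using assms(2) by (auto simp: unit_frechet_def)
  have "prob {\<omega> \<in> space M. Z \<omega> \<le> 0} \<le> exp (- 1 / z)" if "0 < z" for z
    unfolding cdf[OF that, symmetric] using that by (intro finite_measure_mono) auto
  then have "\<forall>\<^sub>F z in at_right 0. prob {\<omega> \<in> space M. Z \<omega> \<le> 0} \<le> exp (- 1 / z)"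
    using eventually_at_right_less[of 0] by (auto elim: eventually_mono)
  then have "prob {\<omega> \<in> space M. Z \<omega> \<le> 0} \<le> 0"
    by (rule tendsto_lowerbound[OF tendsto_exp_neg_inverse_at_right_0]) simp
  then have zero: "prob {\<omega> \<in> space M. Z \<omega> \<le> a} = 0" if "a \<le> 0" for a
  proof -
    have "prob {\<omega> \<in> space M. Z \<omega> \<le> a} \<le> prob {\<omega> \<in> space M. Z \<omega> \<le> 0}"
      using that by (intro finite_measure_mono) auto
    with \<open>prob {\<omega> \<in> space M. Z \<omega> \<le> 0} \<le> 0\<close> show ?thesis
      using measure_nonneg[of M "{\<omega> \<in> space M. Z \<omega> \<le> a}"] by linarith
  qed
  have "distributed M lborel Z (\<lambda>r. ennreal (if 0 < r then exp (- 1 / r) / r\<^sup>2 else 0))"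
  proof (rule distributedI_borel_atMost[where g="\<lambda>a. if 0 < a then exp (- 1 / a) else 0"])
    show "(\<integral>\<^sup>+r. ennreal ((if 0 < r then exp (- 1 / r) / r\<^sup>2 else 0) * indicator {..a} r) \<partial>lborel)
        = ennreal (if 0 < a then exp (- 1 / a) else 0)" for a
      using emeasure_frechet_law_atMost[of a] unfolding frechet_law_def
      by (subst (asm) emeasure_density) (auto simp: ennreal_mult'' ennreal_indicator)
    show "emeasure M {\<omega> \<in> space M. Z \<omega> \<le> a} = ennreal (if 0 < a then exp (- 1 / a) else 0)" for a
      using cdf[of a] zero[of a] by (auto simp: emeasure_eq_measure)
  qed auto
  then have "distr M lborel Z = frechet_law"
    by (simp add: distributed_def frechet_law_def)
  moreover have "distr M borel Z = distr M lborel Z"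
    by (rule distr_cong) auto
  ultimately show ?thesis by simp
qed

text \<open>
  The density of \<open>Z/u\<close>, multiplied by \<open>u\<close>, is \<open>exp (-1/(ur)) / r\<^sup>2\<close>, which increases to the density of
  the tail measure: this is the regular variation of one innovation in its most explicit form.
\<close>

lemma frechet_law_scaling:
  assumes u: "0 < u" and [measurable]: "\<phi> \<in> borel_measurable borel"
  shows "u * (\<integral>r. \<phi> r \<partial>frechet_law) = (\<integral>r. \<phi> (u * r) * exp (- 1 / (u * r)) \<partial>tail_measure)"
proof -
  let ?d = "\<lambda>r::real. if 0 < r then exp (- 1 / r) / r\<^sup>2 else 0"
  have "u * (\<integral>r. \<phi> r \<partial>frechet_law) = u * (\<integral>r. ?d r * \<phi> r \<partial>lborel)"
    unfolding frechet_law_def by (subst integral_density) auto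
  also have "\<dots> = u * (\<bar>u\<bar> *\<^sub>R (\<integral>r. ?d (u * r) * \<phi> (u * r) \<partial>lborel))"
    using u by (subst lborel_integral_real_affine[of u _ 0]) (simp_all cong: if_cong)
  also have "\<dots> = (\<integral>r. u\<^sup>2 * (?d (u * r) * \<phi> (u * r)) \<partial>lborel)"
    using u by (simp add: power2_eq_square)
  also have "\<dots> = (\<integral>r. (if 0 < r then 1 / r\<^sup>2 else 0) * (\<phi> (u * r) * exp (- 1 / (u * r))) \<partial>lborel)"
    using u by (intro Bochner_Integration.integral_cong) (auto simp: zero_less_mult_iff power_mult_distrib)
  also have "\<dots> = (\<integral>r. \<phi> (u * r) * exp (- 1 / (u * r)) \<partial>tail_measure)"
    unfolding tail_measure_def by (subst integral_density) auto
  finally show ?thesis .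
qed

lemma emeasure_frechet_law_le_tail: "emeasure frechet_law A \<le> emeasure tail_measure A"
proof (cases "A \<in> sets borel")
  case True
  then show ?thesis
    unfolding frechet_law_def tail_measure_def
    by (simp add: emeasure_density)
      (auto intro!: nn_integral_mono mult_right_mono ennreal_leI divide_right_mono split: split_indicator)
qed (simp add: emeasure_notin_sets)

lemma exceedance_set:
  assumes "0 \<le> b" "0 < (u::real)"
  shows "{r. u \<le> b * r} = (if b = 0 then {} else {u / b..})"
  using assms by (auto simp: field_simps)

lemma emeasure_tail_measure_exceedance:
  assumes "0 \<le> b" "0 < u"
  shows "emeasure tail_measure {r. u \<le> b * r} = ennreal (b / u)"
  unfolding exceedance_set[OF assms] using assms emeasure_tail_measure_atLeast[of "u / b"] by auto

lemma measure_frechet_law_exceedance: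
  assumes "0 \<le> b" "0 < u"
  shows "measure frechet_law {r. u \<le> b * r} \<le> b / u"
proof -
  have "emeasure frechet_law {r. u \<le> b * r} \<le> ennreal (b / u)"
    using emeasure_frechet_law_le_tail[of "{r. u \<le> b * r}"] emeasure_tail_measure_exceedance[OF assms] by simp
  then show ?thesis
    using assms by (simp add: measure_def enn2real_leI)
qed

section \<open>At most one large innovation matters\<close>

lemma (in prob_space) AE_finitely_many_events:
  fixes E :: "'n::countable \<Rightarrow> 'a set" and p :: "'n \<Rightarrow> real"
  assumes E[measurable]: "\<And>n. E n \<in> events"
    and p: "\<And>n. prob (E n) \<le> p n"
    and int_p: "integrable (count_space UNIV) p"
  shows "AE x in M. finite {n. x \<in> E n}"
proof -
  let ?K = "count_space (UNIV :: 'n set)"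
  interpret K: sigma_finite_measure ?K by (rule sigma_finite_measure_count_space)
  have p0: "0 \<le> p n" for n using p[of n] measure_nonneg[of M "E n"] by linarith
  have "(\<integral>\<^sup>+x. \<integral>\<^sup>+n. indicator (E n) x \<partial>?K \<partial>M) = (\<integral>\<^sup>+n. ennreal (prob (E n)) \<partial>?K)"
    by (subst nn_integral_count_space_nn_integral) (auto simp: emeasure_eq_measure)
  also have "\<dots> \<le> (\<integral>\<^sup>+n. ennreal (p n) \<partial>?K)"
    by (intro nn_integral_mono ennreal_leI p)
  also have "\<dots> = ennreal (\<integral>n. p n \<partial>?K)"
    by (rule nn_integral_eq_integral[OF int_p]) (use p0 in auto)
  finally have "(\<integral>\<^sup>+x. \<integral>\<^sup>+n. indicator (E n) x \<partial>?K \<partial>M) \<noteq> \<infinity>"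
    by (auto simp: top_unique)
  then have "AE x in M. (\<integral>\<^sup>+n. indicator (E n) x \<partial>?K) \<noteq> \<infinity>"
    by (intro nn_integral_PInf_AE) auto
  then show ?thesis
  proof eventually_elim
    fix x assume "(\<integral>\<^sup>+n. indicator (E n) x \<partial>?K) \<noteq> \<infinity>"
    moreover have "(\<integral>\<^sup>+n. indicator (E n) x \<partial>?K) = (\<integral>\<^sup>+n. indicator {n. x \<in> E n} n \<partial>?K)"
      by (intro nn_integral_cong) (auto split: split_indicator)
    ultimately show "finite {n. x \<in> E n}"
      by (auto simp: emeasure_count_space split: if_splits)
  qed
qed

text \<open>
  Only outcomes lying in two of the events contribute to the difference. If \<open>k \<ge> 2\<close> events occur, then
  \<open>h\<close> is counted \<open>k\<close> times instead of once, an error of at most \<open>k C\<close>, and \<open>k\<close> is at most the number \<open>k (k - 1)\<close> of ordered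
  pairs of distinct events that occur. The expected number of these pairs is at most \<open>(\<Sum>\<^sub>n p\<^sub>n)\<^sup>2\<close>.
\<close>

lemma (in prob_space) sum_over_rare_events:
  fixes E :: "'n::countable \<Rightarrow> 'a set" and p :: "'n \<Rightarrow> real" and h :: "'a \<Rightarrow> real"
  assumes E[measurable]: "\<And>n. E n \<in> events"
    and p: "\<And>n. prob (E n) \<le> p n"
    and pairs: "\<And>n m. n \<noteq> m \<Longrightarrow> prob (E n \<inter> E m) \<le> p n * p m"
    and int_p: "integrable (count_space UNIV) p"
    and h[measurable]: "h \<in> borel_measurable M" and C: "\<And>x. \<bar>h x\<bar> \<le> C"
    and zero: "AE x in M. (\<forall>n. x \<notin> E n) \<longrightarrow> h x = 0"
  shows "\<bar>expectation h - (\<integral>n. (\<integral>x. h x * indicator (E n) x \<partial>M) \<partial>count_space UNIV)\<bar>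
    \<le> C * (\<integral>n. p n \<partial>count_space UNIV)\<^sup>2"
proof -
  let ?K = "count_space (UNIV :: 'n set)"
  interpret K: sigma_finite_measure ?K by (rule sigma_finite_measure_count_space)
  interpret pair_sigma_finite ?K M ..
  define S where "S = (\<integral>n. p n \<partial>?K)"
  have p0: "0 \<le> p n" for n using p[of n] measure_nonneg[of M "E n"] by linarith
  have C0: "0 \<le> C" using C[of undefined] by linarith
  have hE: "integrable M (\<lambda>x. h x * indicator (E n) x)" for n
    by (rule integrable_const_bound[where B=C]) (use C C0 in \<open>auto split: split_indicator\<close>)
  have int: "integrable (?K \<Otimes>\<^sub>M M) (\<lambda>(n, x). h x * indicator (E n) x)"
  proof (rule Fubini_integrable)
    show "(\<lambda>(n, x). h x * indicator (E n) x) \<in> borel_measurable (?K \<Otimes>\<^sub>M M)"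
      by (rule measurable_pair_measure_countable1) auto
    show "integrable ?K (\<lambda>n. \<integral>x. norm (case (n, x) of (n, x) \<Rightarrow> h x * indicator (E n) x) \<partial>M)"
    proof (rule Bochner_Integration.integrable_bound[OF integrable_mult_right[OF int_p, of C]])
      show "AE n in ?K. norm (\<integral>x. norm (case (n, x) of (n, x) \<Rightarrow> h x * indicator (E n) x) \<partial>M) \<le> norm (C * p n)"
      proof (rule AE_I2)
        fix n
        have "(\<integral>x. norm (h x * indicator (E n) x) \<partial>M) \<le> (\<integral>x. C * indicator (E n) x \<partial>M)"
          by (intro integral_mono integrable_norm hE)
            (use C in \<open>auto split: split_indicator simp: emeasure_eq_measure intro!: integrable_mult_right integrable_real_indicator\<close>)
        also have "\<dots> = C * prob (E n)" by simp
        also have "\<dots> \<le> C * p n" using p C0 by (intro mult_left_mono) auto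
        finally show "norm (\<integral>x. norm (case (n, x) of (n, x) \<Rightarrow> h x * indicator (E n) x) \<partial>M) \<le> norm (C * p n)"
          using C0 p0 by (simp add: abs_mult)
      qed
    qed auto
    show "AE n in ?K. integrable M (\<lambda>x. case (n, x) of (n, x) \<Rightarrow> h x * indicator (E n) x)"
      using hE by auto
  qed
  have int_h: "integrable M h"
    by (rule integrable_const_bound[where B=C]) (use C in auto)
  define g where "g x = h x - (\<integral>n. h x * indicator (E n) x \<partial>?K)" for x
  have int_g: "integrable M g"
    unfolding g_def
    by (intro Bochner_Integration.integrable_diff integrable_snd[OF int] int_h)
  have eq: "expectation h - (\<integral>n. (\<integral>x. h x * indicator (E n) x \<partial>M) \<partial>?K) = expectation g"
    unfolding g_def
    unfolding Bochner_Integration.integral_diff[OF int_h integrable_snd[OF int]]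
    by (simp only: Fubini_integral[OF int])
  have fin: "AE x in M. finite {n. x \<in> E n}"
    using E p int_p by (rule AE_finitely_many_events)
  define q where "q n m x = (if n \<noteq> m \<and> x \<in> E n \<and> x \<in> E m then 1 else 0 :: ennreal)" for n m x
  have [measurable]: "q n m \<in> borel_measurable M" for n m
    unfolding q_def by measurable
  have bound: "AE x in M. ennreal (norm (g x)) \<le> ennreal C * (\<integral>\<^sup>+n. \<integral>\<^sup>+m. q n m x \<partial>?K \<partial>?K)"
    using fin zero
  proof eventually_elim
    fix x assume fin: "finite {n. x \<in> E n}" and zero: "(\<forall>n. x \<notin> E n) \<longrightarrow> h x = 0"
    define A where "A = {n. x \<in> E n}"
    have "(\<integral>n. h x * indicator (E n) x \<partial>?K) = (\<integral>n. h x * indicator A n \<partial>?K)"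
      by (intro Bochner_Integration.integral_cong) (auto simp: A_def split: split_indicator)
    also have "\<dots> = h x * card A"
      using fin by (simp add: A_def)
    finally have g: "g x = h x * (1 - real (card A))"
      by (simp only: g_def right_diff_distrib mult_1_right)
    show "ennreal (norm (g x)) \<le> ennreal C * (\<integral>\<^sup>+n. \<integral>\<^sup>+m. q n m x \<partial>?K \<partial>?K)"
    proof (cases "card A \<le> 1")
      case True
      then have "card A = 1 \<or> A = {}"
        using fin by (auto simp: A_def le_Suc_eq)
      then have "g x = 0" using g zero by (auto simp: A_def)
      then show ?thesis by simp
    next
      case False
      have "norm (g x) \<le> C * real (card A)"
        unfolding g norm_mult by (intro mult_mono) (use False C C0 in auto)
      then have "ennreal (norm (g x)) \<le> ennreal C * ennreal (real (card A))"
        using C0 by (simp flip: ennreal_mult add: ennreal_leI)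
      also have "ennreal (real (card A)) = (\<integral>\<^sup>+n. indicator A n \<partial>?K)"
        using fin by (simp add: A_def ennreal_of_nat_eq_real_of_nat)
      also have "\<dots> \<le> (\<integral>\<^sup>+n. \<integral>\<^sup>+m. q n m x \<partial>?K \<partial>?K)"
      proof (rule nn_integral_mono)
        fix n
        show "indicator A n \<le> (\<integral>\<^sup>+m. q n m x \<partial>?K)"
        proof (cases "n \<in> A")
          case True
          have "A \<noteq> {n}" using False by auto
          then obtain m where m: "m \<in> A" "n \<noteq> m" using True by auto
          have "q n m x \<le> (\<integral>\<^sup>+m. q n m x \<partial>?K)" by (rule nn_integral_ge_point) simp
          then show ?thesis using m True by (simp add: q_def A_def)
        qed simp
      qed
      finally show ?thesis by (simp add: mult_left_mono)
    qed
  qed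
  have "ennreal \<bar>expectation g\<bar> \<le> (\<integral>\<^sup>+x. norm (g x) \<partial>M)"
    using integral_norm_bound_ennreal[OF int_g] by simp
  also have "\<dots> \<le> (\<integral>\<^sup>+x. ennreal C * (\<integral>\<^sup>+n. \<integral>\<^sup>+m. q n m x \<partial>?K \<partial>?K) \<partial>M)"
    by (rule nn_integral_mono_AE[OF bound])
  also have "\<dots> = ennreal C * (\<integral>\<^sup>+x. \<integral>\<^sup>+n. \<integral>\<^sup>+m. q n m x \<partial>?K \<partial>?K \<partial>M)"
    by (rule nn_integral_cmult) measurable
  also have "(\<integral>\<^sup>+x. \<integral>\<^sup>+n. \<integral>\<^sup>+m. q n m x \<partial>?K \<partial>?K \<partial>M) = (\<integral>\<^sup>+n. \<integral>\<^sup>+x. \<integral>\<^sup>+m. q n m x \<partial>?K \<partial>M \<partial>?K)"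
    by (rule nn_integral_count_space_nn_integral) auto
  also have "\<dots> = (\<integral>\<^sup>+n. \<integral>\<^sup>+m. \<integral>\<^sup>+x. q n m x \<partial>M \<partial>?K \<partial>?K)"
    by (intro nn_integral_cong nn_integral_count_space_nn_integral) auto
  also have "\<dots> \<le> (\<integral>\<^sup>+n. \<integral>\<^sup>+m. ennreal (p n) * ennreal (p m) \<partial>?K \<partial>?K)"
  proof (intro nn_integral_mono)
    fix n m
    show "(\<integral>\<^sup>+x. q n m x \<partial>M) \<le> ennreal (p n) * ennreal (p m)"
    proof (cases "n = m")
      case False
      have "(\<integral>\<^sup>+x. q n m x \<partial>M) = (\<integral>\<^sup>+x. indicator (E n \<inter> E m) x \<partial>M)"
        using False by (intro nn_integral_cong) (auto simp: q_def split: split_indicator)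
      also have "\<dots> \<le> ennreal (p n * p m)"
        using pairs[OF False] by (simp add: emeasure_eq_measure ennreal_leI)
      finally show ?thesis using p0 by (simp add: ennreal_mult)
    qed (simp add: q_def)
  qed
  also have "\<dots> = (\<integral>\<^sup>+n. ennreal (p n) \<partial>?K) * (\<integral>\<^sup>+n. ennreal (p n) \<partial>?K)"
    by (simp add: nn_integral_cmult nn_integral_multc)
  also have "(\<integral>\<^sup>+n. ennreal (p n) \<partial>?K) = ennreal S"
    unfolding S_def by (rule nn_integral_eq_integral[OF int_p]) (use p0 in auto)
  finally have "ennreal \<bar>expectation g\<bar> \<le> ennreal C * (ennreal S * ennreal S)"
    by (simp add: mult_left_mono)
  also have "\<dots> = ennreal (C * S\<^sup>2)"
    using p0 C0 by (simp add: S_def power2_eq_square ennreal_mult)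
  finally show ?thesis
    unfolding eq using C0 by (simp add: S_def)
qed

section \<open>Independent innovations on the product space\<close>

definition innovations :: "('n \<Rightarrow> real) measure"
  where "innovations = PiM UNIV (\<lambda>_. frechet_law)"

lemma space_innovations[simp]: "space innovations = UNIV"
  by (simp add: innovations_def space_PiM)

lemma sets_innovations[measurable_cong]: "sets innovations = sets (PiM UNIV (\<lambda>_. borel))"
  unfolding innovations_def by (rule sets_PiM_cong) simp_all

lemma prob_space_innovations: "prob_space innovations"
  unfolding innovations_def by (intro prob_space_PiM prob_space_frechet_law)

lemma measurable_coordinate[measurable]: "(\<lambda>z. z n) \<in> borel_measurable innovations"
  unfolding measurable_cong_sets[OF sets_innovations refl] by measurable

lemma measurable_upd_pair[measurable]:
  "(\<lambda>(r, z). z(n := r)) \<in> measurable (frechet_law \<Otimes>\<^sub>M innovations) innovations"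
proof -
  have "(\<lambda>(r, z). z(n := r)) \<in> measurable (frechet_law \<Otimes>\<^sub>M innovations) (PiM UNIV (\<lambda>_. borel))"
    by (rule measurable_PiM_single') (auto simp: space_PiM split_beta')
  then show ?thesis
    unfolding measurable_cong_sets[OF refl sets_innovations] .
qed

lemma measurable_upd[measurable]: "(\<lambda>z. z(n := r)) \<in> measurable innovations innovations"
  using measurable_compose[OF measurable_Pair1'[of r frechet_law innovations] measurable_upd_pair] by simp

text \<open>Replacing one innovation by an independent copy does not change the joint law.\<close>

lemma distr_innovations_upd:
  "distr (frechet_law \<Otimes>\<^sub>M innovations) innovations (\<lambda>(r, z). z(n := r)) = innovations"
  using distr_pair_PiM_eq_PiM[of UNIV "\<lambda>_. frechet_law" n] prob_space_frechet_law
  by (simp add: innovations_def)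

lemma integral_innovations_upd:
  fixes h :: "('n \<Rightarrow> real) \<Rightarrow> real"
  assumes h[measurable]: "h \<in> borel_measurable innovations" and C: "\<And>z. \<bar>h z\<bar> \<le> C"
  shows "(\<integral>z. h z \<partial>innovations) = (\<integral>r. \<integral>z. h (z(n := r)) \<partial>innovations \<partial>frechet_law)"
proof -
  interpret F: prob_space frechet_law by (rule prob_space_frechet_law)
  interpret Q: prob_space "innovations :: ('n \<Rightarrow> real) measure" by (rule prob_space_innovations)
  interpret FQ: pair_prob_space frechet_law "innovations :: ('n \<Rightarrow> real) measure" ..
  have m: "(\<lambda>(r, z). h (z(n := r))) \<in> borel_measurable (frechet_law \<Otimes>\<^sub>M innovations)"
    using measurable_compose[OF measurable_upd_pair[of n] h] by (simp add: split_beta')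
  have "(\<integral>z. h z \<partial>innovations) = (\<integral>p. h (case p of (r, z) \<Rightarrow> z(n := r)) \<partial>(frechet_law \<Otimes>\<^sub>M innovations))"
    by (subst distr_innovations_upd[of n, symmetric], subst integral_distr) simp_all
  also have "\<dots> = (\<integral>p. (case p of (r, z) \<Rightarrow> h (z(n := r))) \<partial>(frechet_law \<Otimes>\<^sub>M innovations))"
    by (simp add: split_beta')
  also have "\<dots> = (\<integral>r. \<integral>z. h (z(n := r)) \<partial>innovations \<partial>frechet_law)"
    by (rule FQ.integral_fst[symmetric])
      (rule FQ.P.integrable_const_bound[where B=C, OF _ m], use C in auto)
  finally show ?thesis .
qed

lemma measurable_integral_upd[measurable]:
  fixes h :: "('n \<Rightarrow> real) \<Rightarrow> real"
  assumes h[measurable]: "h \<in> borel_measurable innovations"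
  shows "(\<lambda>r. \<integral>z. h (z(n := r)) \<partial>innovations) \<in> borel_measurable borel"
proof -
  interpret Q: prob_space "innovations :: ('n \<Rightarrow> real) measure" by (rule prob_space_innovations)
  have m: "(\<lambda>(r, z). h (z(n := r))) \<in> borel_measurable (frechet_law \<Otimes>\<^sub>M innovations)"
    using measurable_compose[OF measurable_upd_pair[of n] h] by (simp add: split_beta')
  have "(\<lambda>r. \<integral>z. h (z(n := r)) \<partial>innovations) \<in> borel_measurable frechet_law"
    using Q.borel_measurable_lebesgue_integral[OF m] by simp
  then show ?thesis by simp
qed

lemma distr_innovations_coordinate: "distr innovations borel (\<lambda>z. z n) = frechet_law"
proof -
  have "distr innovations frechet_law (\<lambda>z. z n) = frechet_law"
    unfolding innovations_def by (rule distr_PiM_component) (auto simp: prob_space_frechet_law)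
  moreover have "distr innovations frechet_law (\<lambda>z. z n) = distr innovations borel (\<lambda>z. z n)"
    by (rule distr_cong) simp_all
  ultimately show ?thesis by simp
qed

lemma AE_innovations_pos: "AE z in innovations. \<forall>n::'n::countable. 0 < z n"
proof (rule AE_all_countable[THEN iffD2], rule allI)
  fix n :: 'n
  have "AE r in distr innovations borel (\<lambda>z. z n). 0 < r"
    unfolding distr_innovations_coordinate by (rule AE_frechet_law_pos)
  then show "AE z in innovations. 0 < z n" by (subst (asm) AE_distr_iff) auto
qed

lemma sets_exceedance: "{z. u \<le> b * z n} \<in> sets innovations"
proof -
  have "{z \<in> space innovations. u \<le> b * z n} \<in> sets innovations" by measurable
  then show ?thesis by simp
qed

lemma measure_innovations_exceedance:
  assumes "0 \<le> b" "0 < u"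
  shows "measure innovations {z. u \<le> b * z n} \<le> b / u"
proof -
  have "measure innovations {z. u \<le> b * z n} = measure (distr innovations borel (\<lambda>z. z n)) {r. u \<le> b * r}"
    by (subst measure_distr) (auto simp: vimage_def)
  then show ?thesis
    using measure_frechet_law_exceedance[OF assms] by (simp add: distr_innovations_coordinate)
qed

text \<open>Resampling \<open>z\<^sub>n\<close> leaves the event for \<open>m\<close> unchanged, so the probability factorises.\<close>

lemma measure_innovations_joint_exceedance:
  fixes n m :: 'n
  assumes "0 \<le> b" "0 \<le> b'" "0 < u" and "n \<noteq> m"
  shows "measure innovations ({z. u \<le> b * z n} \<inter> {z. u \<le> b' * z m}) \<le> b / u * (b' / u)"
proof -
  interpret Q: prob_space "innovations :: ('n \<Rightarrow> real) measure" by (rule prob_space_innovations)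
  let ?A = "{z. u \<le> b * z n}" and ?B = "{z. u \<le> b' * z m}"
  have [measurable]: "?A \<in> sets innovations" "?B \<in> sets innovations"
    by (rule sets_exceedance)+
  have "measure innovations (?A \<inter> ?B) = (\<integral>z. indicator ?A z * indicator ?B z \<partial>innovations)"
    by (simp flip: indicator_inter_arith)
  also have "\<dots> = (\<integral>r. \<integral>z. indicator ?A (z(n := r)) * indicator ?B (z(n := r)) \<partial>innovations \<partial>frechet_law)"
    by (rule integral_innovations_upd[where C=1]) (auto split: split_indicator)
  also have "\<dots> = (\<integral>r. \<integral>z. indicator {r. u \<le> b * r} r * indicator ?B z \<partial>innovations \<partial>frechet_law)"
    using \<open>n \<noteq> m\<close> by (intro Bochner_Integration.integral_cong) (auto split: split_indicator)
  also have "\<dots> = measure frechet_law {r. u \<le> b * r} * measure innovations ?B"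
    by simp
  also have "\<dots> \<le> b / u * (b' / u)"
    using assms by (intro mult_mono measure_frechet_law_exceedance measure_innovations_exceedance) auto
  finally show ?thesis .
qed

lemma AE_finite_exceedances:
  fixes b :: "'n::countable \<Rightarrow> real"
  assumes b: "\<And>n. 0 \<le> b n" and int: "integrable (count_space UNIV) b"
  shows "AE z in innovations. \<forall>e>0. finite {n. e \<le> b n * z n}"
proof -
  interpret Q: prob_space "innovations :: ('n \<Rightarrow> real) measure" by (rule prob_space_innovations)
  have "AE z in innovations. finite {n. inverse (real (Suc k)) \<le> b n * z n}" for k
  proof -
    let ?e = "inverse (real (Suc k))"
    have "AE z in innovations. finite {n. z \<in> {z. ?e \<le> b n * z n}}"
    proof (rule Q.AE_finitely_many_events)
      show "measure innovations {z. ?e \<le> b n * z n} \<le> b n / ?e" for n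
        using b by (rule measure_innovations_exceedance) simp
    qed (use int sets_exceedance in auto)
    then show ?thesis by simp
  qed
  then have "AE z in innovations. \<forall>k. finite {n. inverse (real (Suc k)) \<le> b n * z n}"
    by (simp add: AE_all_countable)
  then show ?thesis
  proof eventually_elim
    fix z assume fin: "\<forall>k. finite {n. inverse (real (Suc k)) \<le> b n * z n}"
    show "\<forall>e>0. finite {n. e \<le> b n * z n}"
    proof (intro allI impI)
      fix e :: real assume "e > 0"
      then obtain k where "inverse (real (Suc k)) < e" using reals_Archimedean by blast
      then show "finite {n. e \<le> b n * z n}"
        by (intro finite_subset[OF _ fin[rule_format, of k]]) auto
    qed
  qed
qed

lemma AE_tame:
  fixes c :: "'n::countable \<Rightarrow> ('k::topological_space \<Rightarrow>\<^sub>C real)"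
  assumes "integrable (count_space UNIV) (\<lambda>n. norm (c n))"
  shows "AE z in innovations. tame c z"
  using AE_finite_exceedances[OF _ assms] AE_innovations_pos
  by (auto simp: tame_def less_imp_le elim: eventually_elim2)

section \<open>The single-jump limit\<close>

text \<open>
  Two exceedances \<open>b\<^sub>n z\<^sub>n \<ge> u\<close> together have probability \<open>O (u\<^sup>-\<^sup>2)\<close>, which is negligible against \<open>1/u\<close>, so the
  expectation splits into the contributions of the single innovations. In each of them the exceeding
  innovation is resampled, rescaled by \<open>u\<close> and integrated against the tail measure. Dominated convergence,
  first over the other innovations, then over \<open>r\<close>, then over \<open>n\<close>, gives the limit; the last dominating
  sequence is \<open>C b\<^sub>n\<close>.
\<close>

theorem single_jump_limit:
  fixes H :: "real \<Rightarrow> ('n::countable \<Rightarrow> real) \<Rightarrow> real" and L :: "'n \<Rightarrow> real \<Rightarrow> real"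
  assumes H[measurable]: "\<And>u. H u \<in> borel_measurable innovations"
    and C: "\<And>u z. \<bar>H u z\<bar> \<le> C"
    and b: "\<And>n. 0 \<le> b n" and int_b: "integrable (count_space UNIV) b"
    and zero: "\<And>u. 0 < u \<Longrightarrow> AE z in innovations. (\<forall>n. b n * z n < u) \<longrightarrow> H u z = 0"
    and lim: "\<And>n. AE r in tail_measure. AE z in innovations. ((\<lambda>u. H u (z(n := u * r))) \<longlongrightarrow> L n r) at_top"
    and L: "\<And>n. L n \<in> borel_measurable borel"
    and L0: "\<And>n r. 0 < r \<Longrightarrow> b n * r < 1 \<Longrightarrow> L n r = 0"
  shows "((\<lambda>u. u * (\<integral>z. H u z \<partial>innovations)) \<longlongrightarrow>
    (\<integral>n. (\<integral>r. L n r \<partial>tail_measure) \<partial>count_space UNIV)) at_top"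
proof -
  interpret Q: prob_space "innovations :: ('n \<Rightarrow> real) measure" by (rule prob_space_innovations)
  let ?K = "count_space (UNIV :: 'n set)"
  define S where "S = (\<integral>n. b n \<partial>?K)"
  have C0: "0 \<le> C" using C[of undefined undefined] by linarith
  define E where "E u n = {z. u \<le> b n * z n}" for u and n :: 'n
  have [measurable]: "E u n \<in> sets innovations" for n u
    unfolding E_def by (rule sets_exceedance)
  define T where "T u n = u * (\<integral>z. H u z * indicator (E u n) z \<partial>innovations)" for u n
  define \<phi> where "\<phi> u n r = indicator {r. u \<le> b n * r} r * (\<integral>z. H u (z(n := r)) \<partial>innovations)" for u n r
  have \<phi>: "\<phi> u n \<in> borel_measurable borel" for u n
    unfolding \<phi>_def by measurable
  have H_le: "\<bar>\<integral>z. H u (z(n := r)) \<partial>innovations\<bar> \<le> C" for u n r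
  proof -
    have "\<bar>\<integral>z. H u (z(n := r)) \<partial>innovations\<bar> \<le> (\<integral>z. C \<partial>(innovations :: ('n \<Rightarrow> real) measure))"
      by (rule order.trans[OF integral_abs_bound], intro integral_mono' Q.integrable_const_bound[where B=C])
        (use C C0 in auto)
    then show ?thesis using Q.prob_space by simp
  qed
  \<comment> \<open>The law of the resampled innovation, written as \<open>u r\<close> and multiplied by \<open>u\<close>, has the density
    \<open>exp (-1/(ur))\<close> with respect to the tail measure.\<close>
  have T_eq: "T u n = (\<integral>r. \<phi> u n (u * r) * exp (- 1 / (u * r)) \<partial>tail_measure)" if "0 < u" for u n
  proof -
    have "(\<integral>z. H u z * indicator (E u n) z \<partial>innovations) = (\<integral>r. \<phi> u n r \<partial>frechet_law)"
      by (subst integral_innovations_upd[where C=C and n=n])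
        (use C C0 in \<open>auto simp: \<phi>_def E_def split: split_indicator intro!: Bochner_Integration.integral_cong\<close>)
    then show ?thesis
      unfolding T_def using frechet_law_scaling[OF that \<phi>[of u n]] by simp
  qed
  have T_le: "\<bar>T u n\<bar> \<le> C * b n" if u: "0 < u" for u n
  proof -
    have "\<bar>\<integral>z. H u z * indicator (E u n) z \<partial>innovations\<bar> \<le> (\<integral>z. C * indicator (E u n) z \<partial>innovations)"
      by (rule order.trans[OF integral_abs_bound], intro integral_mono' Q.integrable_const_bound[where B=C])
        (use C C0 in \<open>auto split: split_indicator\<close>)
    also have "\<dots> = C * measure innovations (E u n)" by simp
    also have "\<dots> \<le> C * (b n / u)"
      unfolding E_def using b u C0 by (intro mult_left_mono measure_innovations_exceedance) auto
    finally show ?thesis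
      using u by (simp add: T_def abs_mult field_simps)
  qed
  have T_lim: "((\<lambda>u. T u n) \<longlongrightarrow> (\<integral>r. L n r \<partial>tail_measure)) at_top" for n
  proof -
    have "((\<lambda>u. \<integral>r. \<phi> u n (u * r) * exp (- 1 / (u * r)) \<partial>tail_measure) \<longlongrightarrow> (\<integral>r. L n r \<partial>tail_measure)) at_top"
    proof (rule integral_dominated_convergence_at_top[where w="\<lambda>r. C * indicator {r. 1 \<le> b n * r} r"])
      show "integrable tail_measure (\<lambda>r. C * indicator {r. 1 \<le> b n * r} r)"
        using emeasure_tail_measure_exceedance[OF b, of 1 n]
        by (intro integrable_mult_right integrable_real_indicator) auto
      show "AE r in tail_measure. ((\<lambda>u. \<phi> u n (u * r) * exp (- 1 / (u * r))) \<longlongrightarrow> L n r) at_top"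
        using lim[of n] AE_tail_measure_pos
      proof eventually_elim
        fix r :: real
        assume lim: "AE z in innovations. ((\<lambda>u. H u (z(n := u * r))) \<longlongrightarrow> L n r) at_top" and r: "0 < r"
        have inner: "((\<lambda>u. \<integral>z. H u (z(n := u * r)) \<partial>innovations) \<longlongrightarrow> (\<integral>z. L n r \<partial>(innovations :: ('n \<Rightarrow> real) measure))) at_top"
          by (rule integral_dominated_convergence_at_top[where w="\<lambda>_. C"]) (use lim C in auto)
        have "filterlim (\<lambda>u. u * r) at_top at_top"
          using r by (intro filterlim_at_top_mult_tendsto_pos[OF tendsto_const]) (auto simp: filterlim_ident)
        then have "((\<lambda>u. exp (- 1 / (u * r))) \<longlongrightarrow> exp 0) at_top"
          by (intro tendsto_intros tendsto_divide_0[OF tendsto_const] filterlim_at_top_imp_at_infinity)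
        then have "((\<lambda>u. indicator {r. 1 \<le> b n * r} r * (\<integral>z. H u (z(n := u * r)) \<partial>innovations) * exp (- 1 / (u * r)))
            \<longlongrightarrow> indicator {r. 1 \<le> b n * r} r * L n r * 1) at_top"
          using inner by (intro tendsto_intros) (simp_all add: Q.prob_space[unfolded space_innovations])
        moreover have "indicator {r. 1 \<le> b n * r} r * L n r * 1 = L n r"
          using L0[OF r, of n] by (auto split: split_indicator)
        ultimately have "((\<lambda>u. indicator {r. 1 \<le> b n * r} r * (\<integral>z. H u (z(n := u * r)) \<partial>innovations) * exp (- 1 / (u * r)))
            \<longlongrightarrow> L n r) at_top"
          by (simp only:)
        moreover have "\<forall>\<^sub>F u in at_top. indicator {r. 1 \<le> b n * r} r * (\<integral>z. H u (z(n := u * r)) \<partial>innovations) * exp (- 1 / (u * r))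
            = \<phi> u n (u * r) * exp (- 1 / (u * r))"
          using eventually_gt_at_top[of 0]
          by eventually_elim (auto simp: \<phi>_def algebra_simps split: split_indicator)
        ultimately show "((\<lambda>u. \<phi> u n (u * r) * exp (- 1 / (u * r))) \<longlongrightarrow> L n r) at_top"
          by (rule Lim_transform_eventually)
      qed
      show "\<forall>\<^sub>F u in at_top. AE r in tail_measure.
          norm (\<phi> u n (u * r) * exp (- 1 / (u * r))) \<le> C * indicator {r. 1 \<le> b n * r} r"
        using eventually_gt_at_top[of 0]
      proof eventually_elim
        fix u :: real assume u: "0 < u"
        show "AE r in tail_measure. norm (\<phi> u n (u * r) * exp (- 1 / (u * r))) \<le> C * indicator {r. 1 \<le> b n * r} r"
          using AE_tail_measure_pos
        proof eventually_elim
          fix r :: real assume r: "0 < r"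
          have "\<bar>\<integral>z. H u (z(n := u * r)) \<partial>innovations\<bar> * exp (- 1 / (u * r)) \<le> C * 1"
            using H_le u r C0 by (intro mult_mono) auto
          moreover have "u \<le> b n * (u * r) \<longleftrightarrow> 1 \<le> b n * r"
            using u by (simp add: field_simps)
          ultimately show "norm (\<phi> u n (u * r) * exp (- 1 / (u * r))) \<le> C * indicator {r. 1 \<le> b n * r} r"
            by (auto simp: \<phi>_def abs_mult split: split_indicator)
        qed
      qed
      show "L n \<in> borel_measurable tail_measure"
        using L[of n] measurable_cong_sets[OF sets_tail_measure refl] by blast
      show "(\<lambda>r. \<phi> u n (u * r) * exp (- 1 / (u * r))) \<in> borel_measurable tail_measure" for u
      proof -
        have "(\<lambda>r. \<phi> u n (u * r)) \<in> borel_measurable borel"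
          using measurable_compose[OF _ \<phi>[of u n], of "(*) u" borel] by simp
        moreover have "(\<lambda>r. exp (- 1 / (u * r))) \<in> borel_measurable borel"
          by measurable
        ultimately show ?thesis
          unfolding measurable_cong_sets[OF sets_tail_measure refl] by (rule borel_measurable_times)
      qed
    qed
    then show ?thesis
      by (rule Lim_transform_eventually) (auto simp: T_eq intro: eventually_mono[OF eventually_gt_at_top[of 0]])
  qed
  have sum_lim: "((\<lambda>u. \<integral>n. T u n \<partial>?K) \<longlongrightarrow> (\<integral>n. (\<integral>r. L n r \<partial>tail_measure) \<partial>?K)) at_top"
    by (rule integral_dominated_convergence_at_top[where w="\<lambda>n. C * b n"])
      (use T_le T_lim int_b in \<open>auto intro!: eventually_mono[OF eventually_gt_at_top[of "0::real"]]\<close>)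
  have error: "\<bar>u * (\<integral>z. H u z \<partial>innovations) - (\<integral>n. T u n \<partial>?K)\<bar> \<le> C * S\<^sup>2 / u" if u: "0 < u" for u
  proof -
    have "\<bar>(\<integral>z. H u z \<partial>innovations) - (\<integral>n. (\<integral>z. H u z * indicator (E u n) z \<partial>innovations) \<partial>?K)\<bar>
        \<le> C * (\<integral>n. b n / u \<partial>?K)\<^sup>2"
    proof (rule Q.sum_over_rare_events)
      show "measure innovations (E u n) \<le> b n / u" for n
        unfolding E_def using b u by (intro measure_innovations_exceedance) auto
      show "measure innovations (E u n \<inter> E u m) \<le> b n / u * (b m / u)" if "n \<noteq> m" for n m
        unfolding E_def using b u that by (intro measure_innovations_joint_exceedance) auto
      show "AE z in innovations. (\<forall>n. z \<notin> E u n) \<longrightarrow> H u z = 0"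
        using zero[OF u] by (simp add: E_def not_le)
    qed (use C int_b in auto)
    then have "u * \<bar>(\<integral>z. H u z \<partial>innovations) - (\<integral>n. (\<integral>z. H u z * indicator (E u n) z \<partial>innovations) \<partial>?K)\<bar>
        \<le> u * (C * (S / u)\<^sup>2)"
      using u by (intro mult_left_mono) (auto simp: S_def)
    also have "\<dots> = C * S\<^sup>2 / u"
      using u by (simp add: power2_eq_square)
    also have "u * \<bar>(\<integral>z. H u z \<partial>innovations) - (\<integral>n. (\<integral>z. H u z * indicator (E u n) z \<partial>innovations) \<partial>?K)\<bar>
        = \<bar>u * ((\<integral>z. H u z \<partial>innovations) - (\<integral>n. (\<integral>z. H u z * indicator (E u n) z \<partial>innovations) \<partial>?K))\<bar>"
      using u by (simp add: abs_mult)
    finally show ?thesis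
      by (simp add: T_def right_diff_distrib)
  qed
  have "((\<lambda>u. C * S\<^sup>2 / u) \<longlongrightarrow> 0) at_top"
    by (intro tendsto_divide_0[OF tendsto_const] filterlim_at_top_imp_at_infinity filterlim_ident)
  then have "((\<lambda>u. u * (\<integral>z. H u z \<partial>innovations) - (\<integral>n. T u n \<partial>?K)) \<longlongrightarrow> 0) at_top"
    by (rule Lim_null_comparison[rotated])
      (use error in \<open>auto intro!: eventually_mono[OF eventually_gt_at_top[of "0::real"]]\<close>)
  from tendsto_add[OF this sum_lim] show ?thesis by simp
qed

section \<open>Path space and finite vectors\<close>

lemma tendsto_fun_iff:
  fixes f :: "'a \<Rightarrow> 't \<Rightarrow> 'b::topological_space"
  shows "(f \<longlongrightarrow> l) F \<longleftrightarrow> (\<forall>t. ((\<lambda>x. f x t) \<longlongrightarrow> l t) F)"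
  unfolding limitin_canonical_iff[symmetric] euclidean_product_topology[symmetric] limitin_componentwise
  by simp

lemma borel_measurable_path:
  fixes X :: "'t::countable \<Rightarrow> 'w \<Rightarrow> 'b::second_countable_topology"
  assumes "\<And>t. X t \<in> borel_measurable M"
  shows "(\<lambda>\<omega> t. X t \<omega>) \<in> borel_measurable M"
proof -
  have "(\<lambda>\<omega> t. X t \<omega>) \<in> measurable M (PiM UNIV (\<lambda>_. borel))"
    by (rule measurable_PiM_single') (use assms in auto)
  then show ?thesis
    unfolding measurable_cong_sets[OF refl sets_PiM_equal_borel] .
qed

lemma topspace_vec_top: "topspace (vec_top I) = (\<Pi>\<^sub>E i\<in>I. UNIV)"
  by (simp add: vec_top_def)

lemma space_vec_borel: "space (vec_borel I) = (\<Pi>\<^sub>E i\<in>I. UNIV)"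
  unfolding vec_borel_def topspace_vec_top[symmetric] by (rule space_measure_of) (auto dest: openin_subset)

lemma sets_vec_borel: "sets (vec_borel I) = sigma_sets (topspace (vec_top I)) {U. openin (vec_top I) U}"
  unfolding vec_borel_def by (rule sets_measure_of) (auto dest: openin_subset)

lemma vec_borel_openin: "openin (vec_top I) U \<Longrightarrow> U \<in> sets (vec_borel I)"
  unfolding sets_vec_borel by (rule sigma_sets.Basic) simp

lemma continuous_map_restrict_vec: "continuous_map euclidean (vec_top I) (\<lambda>v. restrict v I)"
  unfolding vec_top_def continuous_map_componentwise
proof (intro conjI ballI)
  fix t assume "t \<in> I"
  then show "continuous_map euclidean euclidean (\<lambda>v. restrict v I t)"
    using continuous_on_product_coordinates[of t] by simp
qed auto

lemma measurable_restrict_vec[measurable]: "(\<lambda>v. restrict v I) \<in> measurable borel (vec_borel I)"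
  unfolding vec_borel_def
proof (rule measurable_measure_of)
  fix U :: "('a \<Rightarrow> 'b) set" assume "U \<in> {U. openin (vec_top I) U}"
  then have "open {v. restrict v I \<in> U}"
    using openin_continuous_map_preimage[OF continuous_map_restrict_vec] by fastforce
  then show "(\<lambda>v. restrict v I) -` U \<inter> space borel \<in> sets borel"
    by (simp add: vimage_def)
qed (use openin_subset[of "vec_top I"] in \<open>force simp: topspace_vec_top\<close>)+

text \<open>Extension by zero, a continuous right inverse of the restriction to \<open>I\<close>.\<close>

definition extend_vec :: "'t set \<Rightarrow> ('t \<Rightarrow> 'b) \<Rightarrow> 't \<Rightarrow> 'b::zero"
  where "extend_vec I v = (\<lambda>t. if t \<in> I then v t else 0)"

lemma continuous_map_extend_vec:
  "continuous_map (vec_top I) euclidean (extend_vec I :: ('t \<Rightarrow> 'b::{topological_space, zero}) \<Rightarrow> _)"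
  unfolding euclidean_product_topology[symmetric] continuous_map_componentwise vec_top_def extend_vec_def
proof (intro conjI ballI)
  fix t
  show "continuous_map (product_topology (\<lambda>_. euclidean) I) euclidean (\<lambda>v. if t \<in> I then v t else 0 :: 'b)"
    by (cases "t \<in> I") (auto intro: continuous_map_product_projection)
qed auto

lemma borel_measurable_vec_borel:
  fixes f :: "('t \<Rightarrow> 'b::topological_space) \<Rightarrow> 'c::topological_space"
  assumes f: "continuous_map (vec_top I) euclidean f"
  shows "f \<in> borel_measurable (vec_borel I)"
proof (rule borel_measurableI)
  fix S :: "'c set" assume "open S"
  then have "openin (vec_top I) {v \<in> topspace (vec_top I). f v \<in> S}"
    using openin_continuous_map_preimage[OF f] by auto
  then have "{v \<in> topspace (vec_top I). f v \<in> S} \<in> sets (vec_borel I)"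
    by (rule vec_borel_openin)
  moreover have "{v \<in> topspace (vec_top I). f v \<in> S} = f -` S \<inter> space (vec_borel I)"
    by (auto simp: topspace_vec_top space_vec_borel)
  ultimately show "f -` S \<inter> space (vec_borel I) \<in> sets (vec_borel I)" by simp
qed

lemma measurable_vec_of:
  fixes X :: "'t::countable \<Rightarrow> 'w \<Rightarrow> 'b::second_countable_topology"
  assumes "\<And>t. X t \<in> borel_measurable M"
  shows "vec_of I X \<in> measurable M (vec_borel I)"
  using measurable_compose[OF borel_measurable_path[OF assms] measurable_restrict_vec[of I]]
  by (simp add: vec_of_def[abs_def])

lemma bounded_continuous_measurable:
  "bounded_continuous I f \<Longrightarrow> f \<in> borel_measurable (vec_borel I)"
  unfolding bounded_continuous_def by (auto intro: borel_measurable_vec_borel)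

lemma bounded_continuous_bounded:
  assumes "bounded_continuous I f"
  obtains C where "\<And>v. \<bar>f (restrict v I)\<bar> \<le> C"
  using assms unfolding bounded_continuous_def topspace_vec_top by (metis restrict_PiE_iff UNIV_I)

lemma bounded_continuous_restrict:
  assumes "bounded_continuous I f"
  shows "continuous_on UNIV (\<lambda>v. f (restrict v I))"
proof -
  have "continuous_map euclidean euclideanreal (f \<circ> (\<lambda>v. restrict v I))"
    using assms continuous_map_restrict_vec continuous_map_compose unfolding bounded_continuous_def by blast
  then show ?thesis by (simp add: comp_def)
qed

section \<open>Laws are determined by bounded continuous functions\<close>

lemma measure_eq_if_integrals_eq:
  fixes \<mu> \<nu> :: "'a::metric_space measure"
  assumes "prob_space \<mu>" "prob_space \<nu>" and sets: "sets \<mu> = sets borel" "sets \<nu> = sets borel"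
    and eq: "\<And>f :: 'a \<Rightarrow> real. continuous_on UNIV f \<Longrightarrow> (\<exists>C. \<forall>x. \<bar>f x\<bar> \<le> C) \<Longrightarrow> (\<integral>x. f x \<partial>\<mu>) = (\<integral>x. f x \<partial>\<nu>)"
  shows "\<mu> = \<nu>"
proof -
  interpret \<mu>: prob_space \<mu> by fact
  interpret \<nu>: prob_space \<nu> by fact
  have space: "space \<mu> = UNIV" "space \<nu> = UNIV"
    using sets_eq_imp_space_eq[OF sets(1)] sets_eq_imp_space_eq[OF sets(2)] by auto
  \<comment> \<open>The indicator of a closed set is a decreasing limit of bounded continuous functions.\<close>
  have lim: "(\<lambda>n. \<integral>x. max 0 (1 - real n * infdist x F) \<partial>\<rho>) \<longlonglongrightarrow> measure \<rho> F"
    if "prob_space \<rho>" "sets \<rho> = sets borel" "closed F" "F \<noteq> {}" for \<rho> and F :: "'a set"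
  proof -
    interpret \<rho>: prob_space \<rho> by fact
    have F: "F \<in> sets \<rho>" using that by simp
    have meas: "(\<lambda>x. max 0 (1 - real n * infdist x F)) \<in> borel_measurable \<rho>" for n
      unfolding measurable_cong_sets[OF that(2) refl]
      by (intro borel_measurable_continuous_onI continuous_intros)
    have pt: "(\<lambda>n. max 0 (1 - real n * infdist x F)) \<longlonglongrightarrow> indicator F x" for x
    proof (cases "x \<in> F")
      case True
      then show ?thesis by simp
    next
      case False
      then have d: "infdist x F > 0"
        using infdist_pos_not_in_closed that by blast
      obtain N where "1 / infdist x F < real N" using reals_Archimedean2 by blast
      then have "1 - real n * infdist x F \<le> 0" if "n \<ge> N" for n
      proof -
        have "1 < real N * infdist x F" using \<open>1 / infdist x F < real N\<close> d by (simp add: field_simps)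
        also have "\<dots> \<le> real n * infdist x F" using that d by (intro mult_right_mono) auto
        finally show ?thesis by simp
      qed
      then have "\<forall>\<^sub>F n in sequentially. max 0 (1 - real n * infdist x F) = 0"
        by (intro eventually_sequentiallyI[of N]) auto
      then show ?thesis using False by (simp add: tendsto_eventually)
    qed
    have "(\<lambda>n. \<integral>x. max 0 (1 - real n * infdist x F) \<partial>\<rho>) \<longlonglongrightarrow> (\<integral>x. indicator F x \<partial>\<rho>)"
      by (rule integral_dominated_convergence[where w="\<lambda>_. 1"])
        (use pt meas F in \<open>auto simp: infdist_nonneg\<close>)
    then show ?thesis using F by simp
  qed
  have closed_eq: "emeasure \<mu> F = emeasure \<nu> F" if F: "closed F" for F
  proof (cases "F = {}")
    case False
    have "(\<integral>x. max 0 (1 - real n * infdist x F) \<partial>\<mu>) = (\<integral>x. max 0 (1 - real n * infdist x F) \<partial>\<nu>)" for n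
      by (intro eq exI[of _ 1] continuous_intros) (auto simp: max_def infdist_nonneg)
    then have "measure \<mu> F = measure \<nu> F"
      using lim[OF assms(1) sets(1) F False] lim[OF assms(2) sets(2) F False] LIMSEQ_unique by force
    then show ?thesis by (simp add: \<mu>.emeasure_eq_measure \<nu>.emeasure_eq_measure)
  qed simp
  show ?thesis
  proof (rule measure_eqI_generator_eq[where E="Collect closed" and A="\<lambda>_. UNIV" and \<Omega>=UNIV])
    show "sets \<mu> = sigma_sets UNIV (Collect closed)" "sets \<nu> = sigma_sets UNIV (Collect closed)"
      using sets by (auto simp: borel_eq_closed)
  qed (use closed_eq \<mu>.emeasure_finite in \<open>auto simp: Int_stable_def\<close>)
qed

text \<open>
  Extension by zero carries the claim to the path space, which is metric as its index set is countable.
\<close>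

lemma vec_measure_eq_if_integrals_eq:
  fixes \<mu> \<nu> :: "('t::countable \<Rightarrow> 'b::{metric_space, zero}) measure"
  assumes "prob_space \<mu>" "prob_space \<nu>"
    and sets: "sets \<mu> = sets (vec_borel I)" "sets \<nu> = sets (vec_borel I)"
    and eq: "\<And>f. bounded_continuous I f \<Longrightarrow> (\<integral>x. f x \<partial>\<mu>) = (\<integral>x. f x \<partial>\<nu>)"
  shows "\<mu> = \<nu>"
proof -
  let ?e = "extend_vec I :: ('t \<Rightarrow> 'b) \<Rightarrow> 't \<Rightarrow> 'b"
  have e: "?e \<in> borel_measurable \<rho>" if "sets \<rho> = sets (vec_borel I)" for \<rho>
    unfolding measurable_cong_sets[OF that refl] by (rule borel_measurable_vec_borel[OF continuous_map_extend_vec])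
  have retract: "distr (distr \<rho> borel ?e) (vec_borel I) (\<lambda>v. restrict v I) = \<rho>"
    if \<rho>: "sets \<rho> = sets (vec_borel I)" for \<rho>
  proof -
    have "distr (distr \<rho> borel ?e) (vec_borel I) (\<lambda>v. restrict v I) = distr \<rho> (vec_borel I) (\<lambda>v. restrict (?e v) I)"
      using e[OF \<rho>] by (subst distr_distr) (simp_all add: comp_def)
    also have "\<dots> = distr \<rho> \<rho> (\<lambda>v. v)"
    proof (rule distr_cong)
      fix v assume "v \<in> space \<rho>"
      then have "v \<in> (\<Pi>\<^sub>E i\<in>I. UNIV)"
        using sets_eq_imp_space_eq[OF \<rho>] by (simp add: space_vec_borel)
      then show "restrict (?e v) I = v"
        by (auto simp: extend_vec_def fun_eq_iff PiE_def extensional_def)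
    qed (use \<rho> in auto)
    finally show ?thesis by (simp add: distr_id)
  qed
  have "distr \<mu> borel ?e = distr \<nu> borel ?e"
  proof (rule measure_eq_if_integrals_eq)
    show "prob_space (distr \<mu> borel ?e)" "prob_space (distr \<nu> borel ?e)"
      by (rule prob_space.prob_space_distr[OF assms(1) e[OF sets(1)]], rule prob_space.prob_space_distr[OF assms(2) e[OF sets(2)]])
    fix f :: "('t \<Rightarrow> 'b) \<Rightarrow> real" assume f: "continuous_on UNIV f" "\<exists>C. \<forall>x. \<bar>f x\<bar> \<le> C"
    have "continuous_map (vec_top I) euclideanreal (f \<circ> ?e)"
      by (rule continuous_map_compose[OF continuous_map_extend_vec]) (simp add: f(1))
    moreover have "\<exists>C. \<forall>v\<in>topspace (vec_top I). \<bar>(f \<circ> ?e) v\<bar> \<le> C"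
      using f(2) by auto
    ultimately have "bounded_continuous I (\<lambda>v. f (?e v))"
      unfolding bounded_continuous_def comp_def ..
    then have "(\<integral>v. f (?e v) \<partial>\<mu>) = (\<integral>v. f (?e v) \<partial>\<nu>)" by (rule eq)
    then show "(\<integral>v. f v \<partial>distr \<mu> borel ?e) = (\<integral>v. f v \<partial>distr \<nu> borel ?e)"
      unfolding integral_distr[OF e[OF sets(1)] borel_measurable_continuous_onI[OF f(1)]]
        integral_distr[OF e[OF sets(2)] borel_measurable_continuous_onI[OF f(1)]] .
  qed simp_all
  then show ?thesis
    using retract[OF sets(1)] retract[OF sets(2)] by metis
qed

section \<open>The tail of a process of suprema\<close>

lemma AE_tame_family:
  fixes c :: "'n::countable \<Rightarrow> 't::countable \<Rightarrow> ('k::topological_space \<Rightarrow>\<^sub>C real)"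
  assumes "\<And>t. integrable (count_space UNIV) (\<lambda>n. norm (c n t))"
  shows "AE z in innovations. \<forall>t. tame (\<lambda>n. c n t) z"
  using AE_tame[OF assms] by (simp add: AE_all_countable)

lemma measurable_max_linear_innovations[measurable]:
  fixes c :: "'n::countable \<Rightarrow> ('k::compact_metric_space \<Rightarrow>\<^sub>C real)"
  shows "(\<lambda>z. max_linear_fun c z) \<in> borel_measurable innovations"
  by (rule measurable_max_linear_fun) (rule measurable_coordinate)

text \<open>
  The value of the process for \<open>z\<^sub>n = u r\<close>, divided by \<open>u\<close>, converges to \<open>r c\<^sub>n\<close> along the whole path.
  So the functional needs to be continuous only at almost all points of the rays \<open>r c\<^sub>n\<close>, which
  admits indicators such as that of \<open>\<parallel>v\<^sub>0\<parallel> \<ge> 1\<close>.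
\<close>

theorem max_linear_process_tail:
  fixes c :: "'n::countable \<Rightarrow> 't::countable \<Rightarrow> ('k::compact_metric_space \<Rightarrow>\<^sub>C real)"
    and g :: "('t \<Rightarrow> ('k \<Rightarrow>\<^sub>C real)) \<Rightarrow> real"
  assumes c: "\<And>n t y. 0 \<le> c n t y"
    and int_c: "\<And>t. integrable (count_space UNIV) (\<lambda>n. norm (c n t))"
    and g[measurable]: "g \<in> borel_measurable borel" and C: "\<And>v. \<bar>g v\<bar> \<le> C"
    and F: "finite F" and \<epsilon>: "0 < \<epsilon>" and g0: "\<And>v. \<forall>t\<in>F. norm (v t) < \<epsilon> \<Longrightarrow> g v = 0"
    and cont: "\<And>n. AE r in tail_measure. isCont g (\<lambda>t. r *\<^sub>R c n t)"
  shows "((\<lambda>u. u * (\<integral>z. g (\<lambda>t. max_linear_fun (\<lambda>n. c n t) z /\<^sub>R u) \<partial>innovations)) \<longlongrightarrow>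
    (\<integral>n. (\<integral>r. g (\<lambda>t. r *\<^sub>R c n t) \<partial>tail_measure) \<partial>count_space UNIV)) at_top"
  \<comment> \<open>The factor \<open>2\<close> leaves room for suprema that are not attained: terms below \<open>u \<epsilon>/2\<close> have a supremum
    below \<open>u \<epsilon>\<close>.\<close>
proof (rule single_jump_limit[where C=C and b="\<lambda>n. 2 / \<epsilon> * (\<Sum>t\<in>F. norm (c n t))"])
  define Y where "Y t z = max_linear_fun (\<lambda>n. c n t) z" for t z
  define b where "b n = 2 / \<epsilon> * (\<Sum>t\<in>F. norm (c n t))" for n
  have b_ge: "2 / \<epsilon> * norm (c n t) \<le> b n" if "t \<in> F" for n t
    unfolding b_def using F \<epsilon> that by (intro mult_left_mono member_le_sum) auto
  have path: "(\<lambda>z t. Y t z /\<^sub>R u) \<in> borel_measurable innovations" for u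
    unfolding Y_def by (rule borel_measurable_path) measurable
  show "(\<lambda>z. g (\<lambda>t. max_linear_fun (\<lambda>n. c n t) z /\<^sub>R u)) \<in> borel_measurable innovations" for u
    using measurable_compose[OF path g] by (simp add: Y_def)
  show "(\<lambda>r. g (\<lambda>t. r *\<^sub>R c n t)) \<in> borel_measurable borel" for n
    by (rule measurable_compose[OF _ g], intro borel_measurable_continuous_onI
        continuous_on_coordinatewise_then_product continuous_intros)
  show "integrable (count_space UNIV) (\<lambda>n. 2 / \<epsilon> * (\<Sum>t\<in>F. norm (c n t)))"
    by (intro integrable_mult_right Bochner_Integration.integrable_sum int_c)
  show "g (\<lambda>t. r *\<^sub>R c n t) = 0" if "0 < r" "2 / \<epsilon> * (\<Sum>t\<in>F. norm (c n t)) * r < 1" for n r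
  proof (rule g0, rule ballI)
    fix t assume "t \<in> F"
    then have "2 / \<epsilon> * norm (c n t) * r \<le> b n * r"
      using b_ge that by (intro mult_right_mono) auto
    then have "2 / \<epsilon> * norm (c n t) * r < 1" using that by (simp add: b_def)
    then have "2 * (r * norm (c n t)) < \<epsilon>"
      using \<epsilon> by (simp add: field_simps)
    moreover have "0 \<le> r * norm (c n t)" using that by simp
    ultimately have "r * norm (c n t) < \<epsilon>" by linarith
    then show "norm (r *\<^sub>R c n t) < \<epsilon>" using that by simp
  qed
  have tame: "AE z in innovations. \<forall>t. tame (\<lambda>n. c n t) z"
    by (rule AE_tame_family[OF int_c])
  show "AE z in innovations. (\<forall>n. 2 / \<epsilon> * (\<Sum>t\<in>F. norm (c n t)) * z n < u) \<longrightarrow>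
      g (\<lambda>t. max_linear_fun (\<lambda>n. c n t) z /\<^sub>R u) = 0" if u: "0 < u" for u
    using tame
  proof eventually_elim
    fix z :: "'n \<Rightarrow> real" assume tame: "\<forall>t. tame (\<lambda>n. c n t) z"
    then have z: "0 \<le> z n" for n by (simp add: tame_def)
    show "(\<forall>n. 2 / \<epsilon> * (\<Sum>t\<in>F. norm (c n t)) * z n < u) \<longrightarrow>
      g (\<lambda>t. max_linear_fun (\<lambda>n. c n t) z /\<^sub>R u) = 0"
    proof (intro impI g0 ballI)
      fix t assume small: "\<forall>n. 2 / \<epsilon> * (\<Sum>t\<in>F. norm (c n t)) * z n < u" and t: "t \<in> F"
      have "norm (c n t) * z n \<le> u * \<epsilon> / 2" for n
      proof -
        have "2 / \<epsilon> * norm (c n t) * z n \<le> b n * z n"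
          using b_ge[OF t] z by (intro mult_right_mono) auto
        then have "2 / \<epsilon> * norm (c n t) * z n < u" using small[rule_format, of n] unfolding b_def by linarith
        then show ?thesis using \<epsilon> by (simp add: field_simps)
      qed
      moreover obtain h where h: "max_linear (\<lambda>n. c n t) z h"
        using ex_max_linear[of "\<lambda>n. c n t" z] tame c by auto
      ultimately have "norm h \<le> u * \<epsilon> / 2"
        using c z by (intro max_linear_norm_le[OF h]) auto
      moreover have "0 < u * \<epsilon>" using u \<epsilon> by simp
      ultimately have "norm h < u * \<epsilon>" by linarith
      then show "norm (max_linear_fun (\<lambda>n. c n t) z /\<^sub>R u) < \<epsilon>"
        using u by (simp add: max_linear_fun_eq[OF h] field_simps)
    qed
  qed
  show "AE r in tail_measure. AE z in innovations.
      ((\<lambda>u. g (\<lambda>t. max_linear_fun (\<lambda>n. c n t) (z(n := u * r)) /\<^sub>R u)) \<longlongrightarrow> g (\<lambda>t. r *\<^sub>R c n t)) at_top" for n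
    using cont[of n] AE_tail_measure_pos
  proof eventually_elim
    fix r :: real assume cont: "isCont g (\<lambda>t. r *\<^sub>R c n t)" and r: "0 < r"
    show "AE z in innovations.
      ((\<lambda>u. g (\<lambda>t. max_linear_fun (\<lambda>n. c n t) (z(n := u * r)) /\<^sub>R u)) \<longlongrightarrow> g (\<lambda>t. r *\<^sub>R c n t)) at_top"
      using tame
    proof eventually_elim
      fix z :: "'n \<Rightarrow> real" assume tame: "\<forall>t. tame (\<lambda>n. c n t) z"
      have "((\<lambda>u. Y t (z(n := u * r)) /\<^sub>R u) \<longlongrightarrow> r *\<^sub>R c n t) at_top" for t
      proof -
        obtain h where h: "max_linear (\<lambda>n. c n t) z h"
          using ex_max_linear[of "\<lambda>n. c n t" z] tame c by auto
        have close: "norm (Y t (z(n := u * r)) /\<^sub>R u - r *\<^sub>R c n t) \<le> norm h / u" if u: "0 < u" for u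
        proof -
          have "tame (\<lambda>n. c n t) (z(n := u * r))"
            using tame u r by (intro tame_fun_upd) auto
          then obtain h' where h': "max_linear (\<lambda>n. c n t) (z(n := u * r)) h'"
            using ex_max_linear[of "\<lambda>n. c n t" "z(n := u * r)"] c by auto
          have le: "norm (h' - (u * r) *\<^sub>R c n t) \<le> norm h"
            using max_linear_fun_upd_near[OF h h'] c tame u r by (auto simp: tame_def)
          have "h' /\<^sub>R u - r *\<^sub>R c n t = (h' - (u * r) *\<^sub>R c n t) /\<^sub>R u"
            using u by (simp add: scaleR_diff_right)
          then have "norm (h' /\<^sub>R u - r *\<^sub>R c n t) = norm (h' - (u * r) *\<^sub>R c n t) / u"
            using u by (simp add: divide_inverse mult.commute)
          then show ?thesis
            using le u by (simp add: Y_def max_linear_fun_eq[OF h'] divide_right_mono)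
        qed
        have "((\<lambda>u. norm h / u) \<longlongrightarrow> 0) at_top"
          by (intro tendsto_divide_0[OF tendsto_const] filterlim_at_top_imp_at_infinity filterlim_ident)
        then have "((\<lambda>u. Y t (z(n := u * r)) /\<^sub>R u - r *\<^sub>R c n t) \<longlongrightarrow> 0) at_top"
          by (rule Lim_null_comparison[rotated])
            (use close in \<open>auto intro: eventually_mono[OF eventually_gt_at_top[of 0]]\<close>)
        then show ?thesis by (simp add: LIM_zero_iff)
      qed
      then have "((\<lambda>u t. Y t (z(n := u * r)) /\<^sub>R u) \<longlongrightarrow> (\<lambda>t. r *\<^sub>R c n t)) at_top"
        by (simp add: tendsto_fun_iff)
      from isCont_tendsto_compose[OF cont this]
      show "((\<lambda>u. g (\<lambda>t. max_linear_fun (\<lambda>n. c n t) (z(n := u * r)) /\<^sub>R u)) \<longlongrightarrow> g (\<lambda>t. r *\<^sub>R c n t)) at_top"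
        by (simp add: Y_def)
    qed
  qed
  show "\<bar>g (\<lambda>t. max_linear_fun (\<lambda>n. c n t) z /\<^sub>R u)\<bar> \<le> C" for u z
    by (rule C)
  show "0 \<le> 2 / \<epsilon> * (\<Sum>t\<in>F. norm (c n t))" for n
    using \<epsilon> by (intro mult_nonneg_nonneg sum_nonneg) auto
qed

section \<open>Regular variation of a process of suprema\<close>

lemma sigma_finite_tail_measure: "sigma_finite_measure tail_measure"
  unfolding tail_measure_def by (subst sigma_finite_measure.sigma_finite_iff_density_finite[OF sigma_finite_lborel]) auto

lemma regularly_varying_fun_inverse: "regularly_varying_fun (\<lambda>u. 1 / u) (- 1)"
  unfolding regularly_varying_fun_def
proof (intro conjI allI impI)
  show "(\<lambda>u::real. 1 / u) \<in> borel_measurable (restrict_space borel {0<..})"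
    by (intro measurable_restrict_space1) measurable
  fix c :: real assume c: "0 < c"
  have "((\<lambda>u. 1 / c) \<longlongrightarrow> c powr - 1) at_top"
    using c by (simp add: powr_minus_divide)
  then show "((\<lambda>u. 1 / (c * u) / (1 / u)) \<longlongrightarrow> c powr - 1) at_top"
    by (rule Lim_transform_eventually)
      (use c in \<open>auto intro: eventually_mono[OF eventually_gt_at_top[of 0]]\<close>)
qed simp

lemma integral_path_law:
  fixes X :: "'t::countable \<Rightarrow> 'w \<Rightarrow> 'b::second_countable_topology"
    and h :: "('t \<Rightarrow> 'b) \<Rightarrow> real"
  assumes "\<And>t. X t \<in> borel_measurable M" "\<And>t. Y t \<in> borel_measurable N"
    and law: "distr M borel (\<lambda>\<omega> t. X t \<omega>) = distr N borel (\<lambda>z t. Y t z)"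
    and h: "h \<in> borel_measurable borel"
  shows "(\<integral>\<omega>. h (\<lambda>t. X t \<omega>) \<partial>M) = (\<integral>z. h (\<lambda>t. Y t z) \<partial>N)"
  using integral_distr[OF borel_measurable_path[where X=X, OF assms(1)] h]
    integral_distr[OF borel_measurable_path[where X=Y, OF assms(2)] h] law by simp

lemma max_linear_process_tail_law:
  fixes c :: "'n::countable \<Rightarrow> 't::countable \<Rightarrow> ('k::compact_metric_space \<Rightarrow>\<^sub>C real)"
    and g :: "('t \<Rightarrow> ('k \<Rightarrow>\<^sub>C real)) \<Rightarrow> real"
  assumes X: "\<And>t. X t \<in> borel_measurable M"
    and law: "distr M borel (\<lambda>\<omega> t. X t \<omega>) = distr innovations borel (\<lambda>z t. max_linear_fun (\<lambda>n. c n t) z)"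
    and c: "\<And>n t y. 0 \<le> c n t y"
    and int_c: "\<And>t. integrable (count_space UNIV) (\<lambda>n. norm (c n t))"
    and g: "g \<in> borel_measurable borel" and C: "\<And>v. \<bar>g v\<bar> \<le> C"
    and F: "finite F" and \<epsilon>: "0 < \<epsilon>" and g0: "\<And>v. \<forall>t\<in>F. norm (v t) < \<epsilon> \<Longrightarrow> g v = 0"
    and cont: "\<And>n. AE r in tail_measure. isCont g (\<lambda>t. r *\<^sub>R c n t)"
  shows "((\<lambda>u. u * (\<integral>\<omega>. g (\<lambda>t. X t \<omega> /\<^sub>R u) \<partial>M)) \<longlongrightarrow>
    (\<integral>n. (\<integral>r. g (\<lambda>t. r *\<^sub>R c n t) \<partial>tail_measure) \<partial>count_space UNIV)) at_top"
proof -
  have "(\<integral>\<omega>. g (\<lambda>t. X t \<omega> /\<^sub>R u) \<partial>M) = (\<integral>z. g (\<lambda>t. max_linear_fun (\<lambda>n. c n t) z /\<^sub>R u) \<partial>innovations)" for u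
  proof (rule integral_path_law[OF X _ law, where h="\<lambda>v. g (\<lambda>t. v t /\<^sub>R u)"])
    show "(\<lambda>v. g (\<lambda>t. v t /\<^sub>R u)) \<in> borel_measurable borel"
      by (rule measurable_compose[OF _ g], intro borel_measurable_continuous_onI
          continuous_on_coordinatewise_then_product continuous_intros continuous_on_product_coordinates)
  qed measurable
  then show ?thesis
    using max_linear_process_tail[OF c int_c g C F \<epsilon> g0 cont] by simp
qed

lemma max_norm_restrict_less_iff:
  assumes "finite I" "I \<noteq> {}"
  shows "max_norm I (restrict v I) < \<epsilon> \<longleftrightarrow> (\<forall>t\<in>I. norm (v t) < \<epsilon>)"
  using assms by (simp add: max_norm_def)

lemma sets_vec_nonzero:
  "- {vec_zero I} \<inter> space (vec_borel I) \<in> sets (vec_borel I :: ('t::countable \<Rightarrow> 'b::real_normed_vector) measure)"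
proof -
  have "(\<lambda>v. v t) \<in> borel_measurable (vec_borel I :: ('t \<Rightarrow> 'b) measure)" if "t \<in> I" for t
    by (rule borel_measurable_vec_borel, unfold vec_top_def)
      (rule continuous_map_product_projection[OF that, of "\<lambda>_. euclidean"])
  then have "(\<lambda>v. v t) -` (- {0}) \<inter> space (vec_borel I :: ('t \<Rightarrow> 'b) measure) \<in> sets (vec_borel I)" if "t \<in> I" for t
    using that by (intro measurable_sets[where A=borel]) auto
  then have "(\<Union>t\<in>I. (\<lambda>v. v t) -` (- {0}) \<inter> space (vec_borel I :: ('t \<Rightarrow> 'b) measure)) \<in> sets (vec_borel I)"
    by (intro sets.countable_UN') auto
  moreover have "(\<Union>t\<in>I. (\<lambda>v. v t) -` (- {0}) \<inter> space (vec_borel I :: ('t \<Rightarrow> 'b) measure))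
      = - {vec_zero I} \<inter> space (vec_borel I)"
    by (force simp: space_vec_borel vec_zero_def fun_eq_iff PiE_def extensional_def)
  ultimately show ?thesis by simp
qed

text \<open>
  The limit measure lives on the countably many rays \<open>{r c\<^sub>n | r > 0}\<close>, each of which carries a copy of the
  tail measure.
\<close>

definition ray_measure :: "('n \<Rightarrow> 't \<Rightarrow> 'b) \<Rightarrow> 't set \<Rightarrow> ('t \<Rightarrow> 'b::real_normed_vector) measure"
  where "ray_measure c I =
    distr (count_space UNIV \<Otimes>\<^sub>M tail_measure) (vec_borel I) (\<lambda>(n, r). \<lambda>t\<in>I. r *\<^sub>R c n t)"

lemma measurable_ray:
  fixes c :: "'n::countable \<Rightarrow> 't::countable \<Rightarrow> 'b::real_normed_vector"
  shows "(\<lambda>(n, r). \<lambda>t\<in>I. r *\<^sub>R c n t) \<in> measurable (count_space UNIV \<Otimes>\<^sub>M tail_measure) (vec_borel I)"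
proof (rule measurable_pair_measure_countable1)
  fix n
  have "(\<lambda>r t. r *\<^sub>R c n t) \<in> borel_measurable borel"
    by (intro borel_measurable_continuous_onI continuous_on_coordinatewise_then_product continuous_intros)
  from measurable_compose[OF this measurable_restrict_vec[of I]]
  show "(\<lambda>r. case (n, r) of (n, r) \<Rightarrow> \<lambda>t\<in>I. r *\<^sub>R c n t) \<in> measurable tail_measure (vec_borel I)"
    unfolding measurable_cong_sets[OF sets_tail_measure refl] by simp
qed simp

lemma AE_ray_exceedance:
  fixes c :: "'n \<Rightarrow> 't \<Rightarrow> 'b::real_normed_vector"
  assumes I: "finite I" "I \<noteq> {}"
  shows "AE r in tail_measure. \<epsilon> \<le> max_norm I (\<lambda>t\<in>I. r *\<^sub>R c n t) \<longrightarrow> \<epsilon> \<le> (\<Sum>t\<in>I. norm (c n t)) * r"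
  using AE_tail_measure_pos
proof eventually_elim
  fix r :: real assume r: "0 < r"
  have "max_norm I (\<lambda>t\<in>I. r *\<^sub>R c n t) \<le> (\<Sum>t\<in>I. norm (c n t)) * r"
  proof -
    have "norm (r *\<^sub>R c n t) \<le> (\<Sum>t\<in>I. norm (c n t)) * r" if "t \<in> I" for t
      using r member_le_sum[OF that, of "\<lambda>t. norm (c n t)"] I by (simp add: mult.commute mult_right_mono)
    then show ?thesis using I by (auto simp: max_norm_def)
  qed
  then show "\<epsilon> \<le> max_norm I (\<lambda>t\<in>I. r *\<^sub>R c n t) \<longrightarrow> \<epsilon> \<le> (\<Sum>t\<in>I. norm (c n t)) * r" by linarith
qed

text \<open>
  Being bounded away from zero means \<open>r \<ge> \<epsilon>/b\<^sub>n\<close> on the \<open>n\<close>-th ray, with \<open>b\<^sub>n = \<Sum>\<^sub>t \<parallel>c\<^sub>n(t)\<parallel>\<close>. This part has mass \<open>b\<^sub>n/\<epsilon>\<close>, and the \<open>b\<^sub>n\<close> are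
  summable.
\<close>

lemma emeasure_ray_measure_finite:
  fixes c :: "'n::countable \<Rightarrow> 't::countable \<Rightarrow> 'b::real_normed_vector"
  assumes I: "finite I" "I \<noteq> {}"
    and int_c: "\<And>t. integrable (count_space UNIV) (\<lambda>n. norm (c n t))"
    and A: "A \<in> sets (vec_borel I)" and \<epsilon>: "0 < \<epsilon>" "\<And>v. v \<in> A \<Longrightarrow> \<epsilon> \<le> max_norm I v"
  shows "emeasure (ray_measure c I) A < \<infinity>"
proof -
  interpret T: sigma_finite_measure tail_measure by (rule sigma_finite_tail_measure)
  let ?ray = "\<lambda>(n, r). \<lambda>t\<in>I. r *\<^sub>R c n t" and ?b = "\<lambda>n. \<Sum>t\<in>I. norm (c n t)"
  let ?P = "count_space UNIV \<Otimes>\<^sub>M tail_measure :: ('n \<times> real) measure"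
  have b: "0 \<le> ?b n" for n by (simp add: sum_nonneg)
  have sets: "?ray -` A \<inter> space ?P \<in> sets ?P"
    using measurable_sets[OF measurable_ray A] .
  have "emeasure (ray_measure c I) A = emeasure ?P (?ray -` A \<inter> space ?P)"
    unfolding ray_measure_def by (rule emeasure_distr[OF measurable_ray A])
  also have "\<dots> = (\<integral>\<^sup>+n. emeasure tail_measure (Pair n -` (?ray -` A \<inter> space ?P)) \<partial>count_space UNIV)"
    by (rule T.emeasure_pair_measure_alt[OF sets])
  also have "\<dots> \<le> (\<integral>\<^sup>+n. ennreal (?b n / \<epsilon>) \<partial>count_space UNIV)"
  proof (rule nn_integral_mono)
    fix n
    have "emeasure tail_measure (Pair n -` (?ray -` A \<inter> space ?P)) \<le> emeasure tail_measure {r. \<epsilon> \<le> ?b n * r}"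
    proof (rule emeasure_mono_AE)
      show "AE r in tail_measure. r \<in> Pair n -` (?ray -` A \<inter> space ?P) \<longrightarrow> r \<in> {r. \<epsilon> \<le> ?b n * r}"
        using AE_ray_exceedance[OF I, of \<epsilon> c n] by eventually_elim (use \<epsilon>(2) in auto)
    qed simp
    then show "emeasure tail_measure (Pair n -` (?ray -` A \<inter> space ?P)) \<le> ennreal (?b n / \<epsilon>)"
      by (simp only: emeasure_tail_measure_exceedance[OF b \<epsilon>(1)])
  qed
  also have "\<dots> = ennreal (\<integral>n. ?b n / \<epsilon> \<partial>count_space UNIV)"
    by (intro nn_integral_eq_integral Bochner_Integration.integrable_divide Bochner_Integration.integrable_sum int_c)
      (use b \<epsilon> in auto)
  also have "\<dots> < \<infinity>" by simp
  finally show ?thesis .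
qed

lemma integral_ray_measure:
  fixes c :: "'n::countable \<Rightarrow> 't::countable \<Rightarrow> 'b::real_normed_vector"
  assumes I: "finite I" "I \<noteq> {}"
    and int_c: "\<And>t. integrable (count_space UNIV) (\<lambda>n. norm (c n t))"
    and f: "f \<in> borel_measurable (vec_borel I)" and C: "\<And>v. \<bar>f (restrict v I)\<bar> \<le> C"
    and \<epsilon>: "0 < \<epsilon>" and f0: "\<And>v. max_norm I (restrict v I) < \<epsilon> \<Longrightarrow> f (restrict v I) = (0::real)"
  shows "(\<integral>v. f v \<partial>ray_measure c I) = (\<integral>n. (\<integral>r. f (\<lambda>t\<in>I. r *\<^sub>R c n t) \<partial>tail_measure) \<partial>count_space UNIV)"
proof -
  interpret T: sigma_finite_measure tail_measure by (rule sigma_finite_tail_measure)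
  let ?K = "count_space (UNIV :: 'n set)" and ?b = "\<lambda>n. \<Sum>t\<in>I. norm (c n t)"
  interpret K: sigma_finite_measure ?K by (rule sigma_finite_measure_count_space)
  interpret KT: pair_sigma_finite ?K tail_measure ..
  have b: "0 \<le> ?b n" for n by (simp add: sum_nonneg)
  have C0: "0 \<le> C" using C[of undefined] by linarith
  have fin: "emeasure tail_measure {r. \<epsilon> \<le> ?b n * r} = ennreal (?b n / \<epsilon>)" for n
    by (rule emeasure_tail_measure_exceedance[OF b \<epsilon>])
  have dom: "integrable tail_measure (\<lambda>r. C * indicator {r. \<epsilon> \<le> ?b n * r} r)" for n
    by (intro integrable_mult_right integrable_real_indicator) (simp_all add: fin)
  have meas: "(\<lambda>(n, r). f (\<lambda>t\<in>I. r *\<^sub>R c n t)) \<in> borel_measurable (?K \<Otimes>\<^sub>M tail_measure)"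
    using measurable_compose[OF measurable_ray f] by (simp add: split_beta')
  have meas': "(\<lambda>r. f (\<lambda>t\<in>I. r *\<^sub>R c n t)) \<in> borel_measurable tail_measure" for n
    using measurable_Pair2[OF meas, of n] by simp
  have bound: "AE r in tail_measure. norm (f (\<lambda>t\<in>I. r *\<^sub>R c n t)) \<le> C * indicator {r. \<epsilon> \<le> ?b n * r} r" for n
    using AE_ray_exceedance[OF I, of \<epsilon> c n]
  proof eventually_elim
    fix r assume "\<epsilon> \<le> max_norm I (\<lambda>t\<in>I. r *\<^sub>R c n t) \<longrightarrow> \<epsilon> \<le> ?b n * r"
    then show "norm (f (\<lambda>t\<in>I. r *\<^sub>R c n t)) \<le> C * indicator {r. \<epsilon> \<le> ?b n * r} r"
      using C[of "\<lambda>t. r *\<^sub>R c n t"] C0 f0[of "\<lambda>t. r *\<^sub>R c n t"]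
      by (auto split: split_indicator simp: not_le[symmetric])
  qed
  have int_r: "integrable tail_measure (\<lambda>r. f (\<lambda>t\<in>I. r *\<^sub>R c n t))" for n
    by (rule Bochner_Integration.integrable_bound[OF dom[of n] meas'])
      (use bound[of n] C0 in \<open>auto elim!: eventually_mono\<close>)
  have "integrable (?K \<Otimes>\<^sub>M tail_measure) (\<lambda>(n, r). f (\<lambda>t\<in>I. r *\<^sub>R c n t))"
  proof (rule KT.Fubini_integrable[OF meas])
    have int_b: "integrable ?K (\<lambda>n. C * (?b n / \<epsilon>))"
      by (intro integrable_mult_right Bochner_Integration.integrable_divide Bochner_Integration.integrable_sum int_c)
    have "(\<integral>r. norm (f (\<lambda>t\<in>I. r *\<^sub>R c n t)) \<partial>tail_measure) \<le> C * (?b n / \<epsilon>)" for n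
    proof -
      have "(\<integral>r. norm (f (\<lambda>t\<in>I. r *\<^sub>R c n t)) \<partial>tail_measure)
          \<le> (\<integral>r. C * indicator {r. \<epsilon> \<le> ?b n * r} r \<partial>tail_measure)"
        by (rule integral_mono_AE[OF integrable_norm[OF int_r] dom bound])
      also have "\<dots> = C * measure tail_measure {r. \<epsilon> \<le> ?b n * r}" by simp
      also have "\<dots> = C * (?b n / \<epsilon>)"
        using b \<epsilon> by (simp add: measure_def fin)
      finally show ?thesis .
    qed
    then show "integrable ?K (\<lambda>n. \<integral>r. norm (case (n, r) of (n, r) \<Rightarrow> f (\<lambda>t\<in>I. r *\<^sub>R c n t)) \<partial>tail_measure)"
      using b \<epsilon> C0 by (intro Bochner_Integration.integrable_bound[OF int_b]) auto
  qed (use int_r in auto)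
  from KT.integral_fst[OF this] show ?thesis
    unfolding ray_measure_def integral_distr[OF measurable_ray f] by (simp add: split_beta')
qed

text \<open>
  The normalisation \<open>1/u\<close> is the tail of a single innovation. The coefficient \<open>c n0 t0\<close> that is not zero
  provides a ray with positive mass.
\<close>

theorem regularly_varying_max_linear:
  fixes c :: "'n::countable \<Rightarrow> 't::countable \<Rightarrow> ('k::compact_metric_space \<Rightarrow>\<^sub>C real)"
  assumes X: "\<And>t. X t \<in> borel_measurable M"
    and law: "distr M borel (\<lambda>\<omega> t. X t \<omega>) = distr innovations borel (\<lambda>z t. max_linear_fun (\<lambda>n. c n t) z)"
    and c: "\<And>n t y. 0 \<le> c n t y"
    and int_c: "\<And>t. integrable (count_space UNIV) (\<lambda>n. norm (c n t))"
    and I: "finite I" "t0 \<in> I" and n0: "c n0 t0 \<noteq> 0"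
  shows "regularly_varying_vec M I X 1"
proof -
  interpret T: sigma_finite_measure tail_measure by (rule sigma_finite_tail_measure)
  have I': "I \<noteq> {}" using I by auto
  define \<mu> where "\<mu> = restrict_space (ray_measure c I) (- {vec_zero I})"
  have sets_ray: "sets (ray_measure c I) = sets (vec_borel I)"
    by (simp add: ray_measure_def)
  have space_ray: "space (ray_measure c I) = space (vec_borel I)"
    by (rule sets_eq_imp_space_eq[OF sets_ray])
  have nonzero: "- {vec_zero I} \<inter> space (ray_measure c I) \<in> sets (ray_measure c I)"
    unfolding space_ray sets_ray by (rule sets_vec_nonzero)
  have sets_\<mu>: "sets \<mu> = sets (restrict_space (vec_borel I) (- {vec_zero I}))"
    unfolding \<mu>_def by (rule sets_restrict_space_cong[OF sets_ray])
  have space_\<mu>: "space \<mu> = - {vec_zero I} \<inter> space (vec_borel I)"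
    by (simp add: \<mu>_def space_restrict_space space_ray)
  have emeasure_\<mu>: "emeasure \<mu> A = emeasure (ray_measure c I) A" "A \<in> sets (vec_borel I)" if "A \<in> sets \<mu>" for A
  proof -
    have "A \<subseteq> - {vec_zero I} \<inter> space (vec_borel I)"
      using sets.sets_into_space[OF that] by (simp add: space_\<mu>)
    then show "emeasure \<mu> A = emeasure (ray_measure c I) A"
      unfolding \<mu>_def by (intro emeasure_restrict_space[OF nonzero]) auto
    show "A \<in> sets (vec_borel I)"
      using that nonzero unfolding \<mu>_def sets_restrict_space_iff[OF nonzero] sets_ray by simp
  qed
  have pos: "emeasure \<mu> (space \<mu>) \<noteq> 0"
  proof -
    let ?ray = "\<lambda>(n, r). \<lambda>t\<in>I. r *\<^sub>R c n t"
    let ?P = "count_space UNIV \<Otimes>\<^sub>M tail_measure :: ('n \<times> real) measure"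
    have "{n0} \<times> {1..} \<subseteq> ?ray -` (space \<mu>) \<inter> space ?P"
    proof
      fix p assume "p \<in> {n0} \<times> {1::real..}"
      then obtain r where p: "p = (n0, r)" "1 \<le> r" by auto
      have "?ray p t0 \<noteq> vec_zero I t0"
        using n0 p I by (simp add: vec_zero_def)
      then have "?ray p \<noteq> vec_zero I" by metis
      moreover have "?ray p \<in> space (vec_borel I)" using p by (simp add: space_vec_borel)
      ultimately show "p \<in> ?ray -` (space \<mu>) \<inter> space ?P"
        by (simp add: space_\<mu> space_pair_measure)
    qed
    moreover have space\<mu>: "space \<mu> \<in> sets (vec_borel I)"
      unfolding space_\<mu> by (rule sets_vec_nonzero)
    ultimately have "emeasure ?P ({n0} \<times> {1..}) \<le> emeasure ?P (?ray -` (space \<mu>) \<inter> space ?P)"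
      by (intro emeasure_mono measurable_sets[OF measurable_ray])
    moreover have "emeasure ?P ({n0} \<times> {1..}) = emeasure (count_space UNIV) {n0} * emeasure tail_measure {1..}"
      by (rule T.emeasure_pair_measure_Times) auto
    moreover have "emeasure (ray_measure c I) (space \<mu>) = emeasure ?P (?ray -` (space \<mu>) \<inter> space ?P)"
      unfolding ray_measure_def by (rule emeasure_distr[OF measurable_ray space\<mu>])
    ultimately have "1 \<le> emeasure (ray_measure c I) (space \<mu>)"
      using emeasure_tail_measure_atLeast[of 1] by (simp add: one_ennreal_def[symmetric])
    then show ?thesis
      using emeasure_\<mu>(1)[OF sets.top] by auto
  qed
  have fin: "emeasure \<mu> A < \<infinity>" if A: "A \<in> sets \<mu>" and \<epsilon>: "\<exists>\<epsilon>>0. \<forall>v\<in>A. \<epsilon> \<le> max_norm I v" for A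
  proof -
    obtain \<epsilon> where "0 < \<epsilon>" "\<And>v. v \<in> A \<Longrightarrow> \<epsilon> \<le> max_norm I v" using \<epsilon> by blast
    then show ?thesis
      unfolding emeasure_\<mu>(1)[OF A] by (intro emeasure_ray_measure_finite I I' int_c emeasure_\<mu>(2)[OF A])
  qed
  have conv: "((\<lambda>u. (\<integral>\<omega>. f (vec_of I (\<lambda>i \<omega>. X i \<omega> /\<^sub>R u) \<omega>) \<partial>M) / (1 / u)) \<longlongrightarrow> (\<integral>v. f v \<partial>\<mu>)) at_top"
    if f: "bounded_continuous I f" and f0: "\<exists>\<epsilon>>0. \<forall>v\<in>topspace (vec_top I). max_norm I v < \<epsilon> \<longrightarrow> f v = 0" for f
  proof -
    obtain \<epsilon> where \<epsilon>: "0 < \<epsilon>" "\<And>v. max_norm I (restrict v I) < \<epsilon> \<Longrightarrow> f (restrict v I) = 0"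
      using f0 by (auto simp: topspace_vec_top)
    obtain C where C: "\<And>v. \<bar>f (restrict v I)\<bar> \<le> C"
      using bounded_continuous_bounded[OF f] by blast
    note cont = bounded_continuous_restrict[OF f]
    have zero: "f (vec_zero I) = 0"
      using \<epsilon>(2)[of "vec_zero I"] \<epsilon>(1) I(1) I' by (simp add: vec_zero_def max_norm_def)
    have "(\<integral>v. f v \<partial>\<mu>) = (\<integral>v. indicator (- {vec_zero I}) v *\<^sub>R f v \<partial>ray_measure c I)"
      unfolding \<mu>_def by (rule integral_restrict_space[OF nonzero])
    also have "\<dots> = (\<integral>v. f v \<partial>ray_measure c I)"
      using zero by (intro Bochner_Integration.integral_cong) (auto split: split_indicator)
    also have "\<dots> = (\<integral>n. (\<integral>r. f (\<lambda>t\<in>I. r *\<^sub>R c n t) \<partial>tail_measure) \<partial>count_space UNIV)"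
      by (rule integral_ray_measure[OF I(1) I' int_c bounded_continuous_measurable[OF f] C \<epsilon>])
    finally have lim_eq: "(\<integral>v. f v \<partial>\<mu>) = (\<integral>n. (\<integral>r. f (\<lambda>t\<in>I. r *\<^sub>R c n t) \<partial>tail_measure) \<partial>count_space UNIV)" .
    have "((\<lambda>u. u * (\<integral>\<omega>. f (restrict (\<lambda>t. X t \<omega> /\<^sub>R u) I) \<partial>M)) \<longlongrightarrow>
        (\<integral>n. (\<integral>r. f (restrict (\<lambda>t. r *\<^sub>R c n t) I) \<partial>tail_measure) \<partial>count_space UNIV)) at_top"
    proof (rule max_linear_process_tail_law[OF X law c int_c _ C I(1) \<epsilon>(1)])
      show "(\<lambda>v. f (restrict v I)) \<in> borel_measurable borel"
        by (rule borel_measurable_continuous_onI[OF cont])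
      show "f (restrict v I) = 0" if "\<forall>t\<in>I. norm (v t) < \<epsilon>" for v
        using \<epsilon>(2) that max_norm_restrict_less_iff[OF I(1) I'] by blast
      show "AE r in tail_measure. isCont (\<lambda>v. f (restrict v I)) (\<lambda>t. r *\<^sub>R c n t)" for n
        using cont by (simp add: continuous_on_eq_continuous_at)
    qed
    then show ?thesis
      unfolding lim_eq by (simp add: vec_of_def mult.commute)
  qed
  show ?thesis
    unfolding regularly_varying_vec_def
    using measurable_vec_of[OF X, of I] regularly_varying_fun_inverse sets_\<mu> pos fin conv
    by (intro conjI exI[of _ "\<lambda>u. 1 / u"] exI[of _ \<mu>]) auto
qed

section \<open>The spectral limit of a process of suprema\<close>

lemma integral_uniform_measure:
  fixes f :: "'a \<Rightarrow> real"
  assumes "finite_measure M" "A \<in> sets M" "measure M A \<noteq> 0" and f: "f \<in> borel_measurable M"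
  shows "(\<integral>x. f x \<partial>uniform_measure M A) = (\<integral>x. indicator A x * f x \<partial>M) / measure M A"
proof -
  interpret finite_measure M by fact
  have pos: "0 < measure M A" using assms(3) by (simp add: zero_less_measure_iff)
  have "uniform_measure M A = density M (\<lambda>x. ennreal (indicator A x / measure M A))"
    unfolding uniform_measure_def
    by (intro density_cong)
      (use assms pos in \<open>auto simp: emeasure_eq_measure divide_ennreal[symmetric] ennreal_indicator\<close>)
  then have "(\<integral>x. f x \<partial>uniform_measure M A) = (\<integral>x. (indicator A x / measure M A) *\<^sub>R f x \<partial>M)"
    using assms by (simp only:) (rule integral_density, auto)
  then show ?thesis by simp
qed

text \<open>
  On the ray of \<open>c\<^sub>n\<close> the normalised path is constantly \<open>c\<^sub>n / \<parallel>c\<^sub>n(t0)\<parallel>\<close>, and the condition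
  \<open>r \<parallel>c\<^sub>n(t0)\<parallel> \<ge> 1\<close> has tail measure \<open>\<parallel>c\<^sub>n(t0)\<parallel>\<close>, which is the weight of that path. The indicator of the
  condition is discontinuous at a single point of the ray.
\<close>

lemma normalised_tail_limit:
  fixes c :: "'n::countable \<Rightarrow> 't::countable \<Rightarrow> ('k::compact_metric_space \<Rightarrow>\<^sub>C real)"
    and f :: "('t \<Rightarrow> ('k \<Rightarrow>\<^sub>C real)) \<Rightarrow> real"
  assumes X: "\<And>t. X t \<in> borel_measurable M"
    and law: "distr M borel (\<lambda>\<omega> t. X t \<omega>) = distr innovations borel (\<lambda>z t. max_linear_fun (\<lambda>n. c n t) z)"
    and c: "\<And>n t y. 0 \<le> c n t y"
    and int_c: "\<And>t. integrable (count_space UNIV) (\<lambda>n. norm (c n t))"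
    and cont: "continuous_on UNIV f" and C: "\<And>v. \<bar>f v\<bar> \<le> C"
  shows "((\<lambda>x. x * (\<integral>\<omega>. indicator {\<omega> \<in> space M. x \<le> norm (X t0 \<omega>)} \<omega> * f (\<lambda>t. X t \<omega> /\<^sub>R norm (X t0 \<omega>)) \<partial>M))
    \<longlongrightarrow> (\<integral>n. norm (c n t0) * f (\<lambda>t. c n t /\<^sub>R norm (c n t0)) \<partial>count_space UNIV)) at_top"
proof -
  define g where "g v = (if 1 \<le> norm (v t0) then f (\<lambda>t. v t /\<^sub>R norm (v t0)) else 0)" for v
  have coord: "((\<lambda>v. v t) \<longlongrightarrow> v t) (nhds v)" for t and v :: "'t \<Rightarrow> ('k \<Rightarrow>\<^sub>C real)"
    using filterlim_ident[of "nhds v"] unfolding tendsto_fun_iff by blast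
  then have coord_at: "((\<lambda>v. v t) \<longlongrightarrow> v t) (at v)" for t and v :: "'t \<Rightarrow> ('k \<Rightarrow>\<^sub>C real)"
    by (rule tendsto_mono[rotated]) (simp add: at_within_def)
  have meas_coord: "(\<lambda>v. v t) \<in> borel_measurable (borel :: ('t \<Rightarrow> ('k \<Rightarrow>\<^sub>C real)) measure)" for t
    by (rule borel_measurable_continuous_onI) simp
  have meas_norm: "(\<lambda>v. norm (v t0)) \<in> borel_measurable (borel :: ('t \<Rightarrow> ('k \<Rightarrow>\<^sub>C real)) measure)"
    by (rule measurable_compose[OF meas_coord borel_measurable_norm])
  have "(\<lambda>v t. v t /\<^sub>R norm (v t0)) \<in> borel_measurable (borel :: ('t \<Rightarrow> ('k \<Rightarrow>\<^sub>C real)) measure)"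
    by (intro borel_measurable_path borel_measurable_scaleR borel_measurable_inverse
        meas_norm meas_coord)
  from measurable_compose[OF this borel_measurable_continuous_onI[OF cont]]
  have g: "g \<in> borel_measurable borel"
    unfolding g_def
    using borel_measurable_le[OF borel_measurable_const meas_norm, of 1]
    by (intro measurable_If) auto
  have cont_g: "isCont g v" if v: "norm (v t0) \<noteq> 1" for v
  proof (cases "norm (v t0) < 1")
    case True
    have "((\<lambda>v. norm (v t0)) \<longlongrightarrow> norm (v t0)) (nhds v)"
      by (rule tendsto_norm[OF coord])
    then have "\<forall>\<^sub>F v' in nhds v. norm (v' t0) < 1"
      using True by (rule order_tendstoD)
    then have "\<forall>\<^sub>F v' in nhds v. g v' = 0"
      by eventually_elim (simp add: g_def)
    then show ?thesis by (simp add: isCont_cong[of g "\<lambda>_. 0"])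
  next
    case False
    then have gt: "1 < norm (v t0)" using v by simp
    have "((\<lambda>v. norm (v t0)) \<longlongrightarrow> norm (v t0)) (nhds v)"
      by (rule tendsto_norm[OF coord])
    then have "\<forall>\<^sub>F v' in nhds v. 1 < norm (v' t0)"
      using gt by (rule order_tendstoD)
    then have eq: "\<forall>\<^sub>F v' in nhds v. g v' = f (\<lambda>t. v' t /\<^sub>R norm (v' t0))"
      by eventually_elim (simp add: g_def)
    have "((\<lambda>v' t. v' t /\<^sub>R norm (v' t0)) \<longlongrightarrow> (\<lambda>t. v t /\<^sub>R norm (v t0))) (at v)"
      unfolding tendsto_fun_iff
      using gt by (intro allI tendsto_scaleR tendsto_inverse tendsto_norm coord_at) auto
    then have "isCont (\<lambda>v'. f (\<lambda>t. v' t /\<^sub>R norm (v' t0))) v"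
      unfolding isCont_def
      using cont by (intro isCont_tendsto_compose[of _ f]) (auto simp: continuous_on_eq_continuous_at)
    then show ?thesis by (simp add: isCont_cong[OF eq])
  qed
  have lim: "((\<lambda>u. u * (\<integral>\<omega>. g (\<lambda>t. X t \<omega> /\<^sub>R u) \<partial>M)) \<longlongrightarrow>
      (\<integral>n. (\<integral>r. g (\<lambda>t. r *\<^sub>R c n t) \<partial>tail_measure) \<partial>count_space UNIV)) at_top"
  proof (rule max_linear_process_tail_law[OF X law c int_c g, where C=C and F="{t0}" and \<epsilon>=1])
    show "\<bar>g v\<bar> \<le> C" for v
      using C order.trans[OF abs_ge_zero C] by (auto simp: g_def)
    show "AE r in tail_measure. isCont g (\<lambda>t. r *\<^sub>R c n t)" for n
    proof -
      have "AE r in tail_measure. r \<noteq> 1 / norm (c n t0)"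
        unfolding tail_measure_def
        by (subst AE_density) (auto intro: eventually_mono[OF AE_lborel_singleton[of "1 / norm (c n t0)"]])
      with AE_tail_measure_pos show ?thesis
      proof eventually_elim
        fix r :: real assume "0 < r" "r \<noteq> 1 / norm (c n t0)"
        then have "norm (r *\<^sub>R c n t0) \<noteq> 1"
          by (cases "norm (c n t0) = 0") (auto simp: eq_divide_eq)
        then show "isCont g (\<lambda>t. r *\<^sub>R c n t)" by (rule cont_g)
      qed
    qed
  qed (auto simp: g_def)
  have ray: "(\<integral>r. g (\<lambda>t. r *\<^sub>R c n t) \<partial>tail_measure) = norm (c n t0) * f (\<lambda>t. c n t /\<^sub>R norm (c n t0))" for n
  proof -
    have "(\<integral>r. g (\<lambda>t. r *\<^sub>R c n t) \<partial>tail_measure)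
        = (\<integral>r. indicator {r. 1 \<le> norm (c n t0) * r} r * f (\<lambda>t. c n t /\<^sub>R norm (c n t0)) \<partial>tail_measure)"
    proof (rule integral_cong_AE)
      show "(\<lambda>r. g (\<lambda>t. r *\<^sub>R c n t)) \<in> borel_measurable tail_measure"
        unfolding measurable_cong_sets[OF sets_tail_measure refl]
        by (rule measurable_compose[OF _ g], intro borel_measurable_continuous_onI
            continuous_on_coordinatewise_then_product continuous_intros)
      show "AE r in tail_measure. g (\<lambda>t. r *\<^sub>R c n t)
          = indicator {r. 1 \<le> norm (c n t0) * r} r * f (\<lambda>t. c n t /\<^sub>R norm (c n t0))"
        using AE_tail_measure_pos
      proof eventually_elim
        fix r :: real assume r: "0 < r"
        then have "(\<lambda>t. (r *\<^sub>R c n t) /\<^sub>R norm (r *\<^sub>R c n t0)) = (\<lambda>t. c n t /\<^sub>R norm (c n t0))"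
          by (intro ext) simp
        then show "g (\<lambda>t. r *\<^sub>R c n t)
          = indicator {r. 1 \<le> norm (c n t0) * r} r * f (\<lambda>t. c n t /\<^sub>R norm (c n t0))"
          unfolding g_def using r by (simp only:) (auto simp: mult.commute split: split_indicator)
      qed
      show "(\<lambda>r. indicator {r. 1 \<le> norm (c n t0) * r} r * f (\<lambda>t. c n t /\<^sub>R norm (c n t0)))
          \<in> borel_measurable tail_measure"
        by (intro borel_measurable_times borel_measurable_const borel_measurable_indicator) simp
    qed
    also have "\<dots> = measure tail_measure {r. 1 \<le> norm (c n t0) * r} * f (\<lambda>t. c n t /\<^sub>R norm (c n t0))"
      by simp
    also have "measure tail_measure {r. 1 \<le> norm (c n t0) * r} = norm (c n t0)"
      using emeasure_tail_measure_exceedance[of "norm (c n t0)" 1] by (simp add: measure_def)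
    finally show ?thesis .
  qed
  have "\<forall>\<^sub>F x in at_top. x * (\<integral>\<omega>. g (\<lambda>t. X t \<omega> /\<^sub>R x) \<partial>M)
      = x * (\<integral>\<omega>. indicator {\<omega> \<in> space M. x \<le> norm (X t0 \<omega>)} \<omega> * f (\<lambda>t. X t \<omega> /\<^sub>R norm (X t0 \<omega>)) \<partial>M)"
    using eventually_gt_at_top[of 0]
  proof eventually_elim
    fix x :: real assume x: "0 < x"
    have "g (\<lambda>t. X t \<omega> /\<^sub>R x)
        = indicator {\<omega> \<in> space M. x \<le> norm (X t0 \<omega>)} \<omega> * f (\<lambda>t. X t \<omega> /\<^sub>R norm (X t0 \<omega>))"
      if "\<omega> \<in> space M" for \<omega>
    proof -
      have "(\<lambda>t. (X t \<omega> /\<^sub>R x) /\<^sub>R norm (X t0 \<omega> /\<^sub>R x)) = (\<lambda>t. X t \<omega> /\<^sub>R norm (X t0 \<omega>))"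
        using x by (intro ext) simp
      moreover have "1 \<le> norm (X t0 \<omega> /\<^sub>R x) \<longleftrightarrow> x \<le> norm (X t0 \<omega>)"
        using x by (simp add: field_simps)
      ultimately show ?thesis
        unfolding g_def using that by (simp only:) (auto split: split_indicator)
    qed
    then show "x * (\<integral>\<omega>. g (\<lambda>t. X t \<omega> /\<^sub>R x) \<partial>M)
      = x * (\<integral>\<omega>. indicator {\<omega> \<in> space M. x \<le> norm (X t0 \<omega>)} \<omega> * f (\<lambda>t. X t \<omega> /\<^sub>R norm (X t0 \<omega>)) \<partial>M)"
      by (simp cong: Bochner_Integration.integral_cong)
  qed
  from Lim_transform_eventually[OF lim this] show ?thesis
    by (simp only: ray)
qed

text \<open>The conditional expectation is a quotient of two tail limits, the denominator being that of \<open>f = 1\<close>.\<close>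

theorem spectral_limit_max_linear:
  fixes c :: "'n::countable \<Rightarrow> 't::countable \<Rightarrow> ('k::compact_metric_space \<Rightarrow>\<^sub>C real)"
  assumes M: "prob_space M" and X: "\<And>t. X t \<in> borel_measurable M"
    and law: "distr M borel (\<lambda>\<omega> t. X t \<omega>) = distr innovations borel (\<lambda>z t. max_linear_fun (\<lambda>n. c n t) z)"
    and c: "\<And>n t y. 0 \<le> c n t y"
    and int_c: "\<And>t. integrable (count_space UNIV) (\<lambda>n. norm (c n t))"
    and n0: "c n0 t0 \<noteq> 0" and f: "bounded_continuous I f"
  shows "((\<lambda>x. \<integral>v. f v \<partial>vec_law (uniform_measure M {\<omega> \<in> space M. norm (X t0 \<omega>) \<ge> x}) I
               (\<lambda>i \<omega>. X i \<omega> /\<^sub>R norm (X t0 \<omega>)))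
    \<longlongrightarrow> (\<integral>n. norm (c n t0) * f (\<lambda>t\<in>I. c n t /\<^sub>R norm (c n t0)) \<partial>count_space UNIV)
        / (\<integral>n. norm (c n t0) \<partial>count_space UNIV)) at_top"
proof -
  interpret prob_space M by fact
  note X[measurable]
  define E where "E x = {\<omega> \<in> space M. x \<le> norm (X t0 \<omega>)}" for x
  have E[measurable]: "E x \<in> events" for x unfolding E_def by measurable
  define W where "W = (\<integral>n. norm (c n t0) \<partial>count_space UNIV)"
  have W: "0 < W"
  proof -
    have "0 < norm (c n0 t0)" using n0 by simp
    also have "norm (c n0 t0) = (\<integral>n. indicator {n0} n * norm (c n0 t0) \<partial>count_space UNIV)" by simp
    also have "\<dots> \<le> W"
      unfolding W_def by (rule integral_mono')
        (use int_c[of t0] in \<open>auto split: split_indicator\<close>)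
    finally show ?thesis .
  qed
  obtain C where C: "\<And>v. \<bar>f (restrict v I)\<bar> \<le> C"
    using bounded_continuous_bounded[OF f] by blast
  have num: "((\<lambda>x. x * (\<integral>\<omega>. indicator (E x) \<omega> * f (\<lambda>t\<in>I. X t \<omega> /\<^sub>R norm (X t0 \<omega>)) \<partial>M))
      \<longlongrightarrow> (\<integral>n. norm (c n t0) * f (\<lambda>t\<in>I. c n t /\<^sub>R norm (c n t0)) \<partial>count_space UNIV)) at_top"
    unfolding E_def
    by (rule normalised_tail_limit[OF X law c int_c bounded_continuous_restrict[OF f] C])
  have "((\<lambda>x. x * (\<integral>\<omega>. indicator (E x) \<omega> * 1 \<partial>M)) \<longlongrightarrow> (\<integral>n. norm (c n t0) * 1 \<partial>count_space UNIV)) at_top"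
    unfolding E_def
    by (rule normalised_tail_limit[OF X law c int_c, where f="\<lambda>_. 1" and C=1]) auto
  then have den: "((\<lambda>x. x * prob (E x)) \<longlongrightarrow> W) at_top"
    by (simp add: W_def)
  have quot: "((\<lambda>x. (x * (\<integral>\<omega>. indicator (E x) \<omega> * f (\<lambda>t\<in>I. X t \<omega> /\<^sub>R norm (X t0 \<omega>)) \<partial>M)) / (x * prob (E x)))
      \<longlongrightarrow> (\<integral>n. norm (c n t0) * f (\<lambda>t\<in>I. c n t /\<^sub>R norm (c n t0)) \<partial>count_space UNIV) / W) at_top"
    using W by (intro tendsto_divide num den) simp
  have fX: "(\<lambda>\<omega>. f (vec_of I (\<lambda>i \<omega>. X i \<omega> /\<^sub>R norm (X t0 \<omega>)) \<omega>)) \<in> borel_measurable M"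
    and vX: "vec_of I (\<lambda>i \<omega>. X i \<omega> /\<^sub>R norm (X t0 \<omega>)) \<in> measurable M (vec_borel I)"
  proof -
    show vX: "vec_of I (\<lambda>i \<omega>. X i \<omega> /\<^sub>R norm (X t0 \<omega>)) \<in> measurable M (vec_borel I)"
      by (rule measurable_vec_of) measurable
    show "(\<lambda>\<omega>. f (vec_of I (\<lambda>i \<omega>. X i \<omega> /\<^sub>R norm (X t0 \<omega>)) \<omega>)) \<in> borel_measurable M"
      by (rule measurable_compose[OF vX bounded_continuous_measurable[OF f]])
  qed
  have "\<forall>\<^sub>F x in at_top. 0 < x * prob (E x)"
    using den W by (rule order_tendstoD)
  then have "\<forall>\<^sub>F x in at_top. (x * (\<integral>\<omega>. indicator (E x) \<omega> * f (\<lambda>t\<in>I. X t \<omega> /\<^sub>R norm (X t0 \<omega>)) \<partial>M)) / (x * prob (E x))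
      = (\<integral>v. f v \<partial>vec_law (uniform_measure M (E x)) I (\<lambda>i \<omega>. X i \<omega> /\<^sub>R norm (X t0 \<omega>)))"
  proof eventually_elim
    fix x assume pos: "0 < x * prob (E x)"
    have vX': "vec_of I (\<lambda>i \<omega>. X i \<omega> /\<^sub>R norm (X t0 \<omega>)) \<in> measurable (uniform_measure M (E x)) (vec_borel I)"
      using vX by (simp cong: measurable_cong_sets)
    have "(\<integral>v. f v \<partial>vec_law (uniform_measure M (E x)) I (\<lambda>i \<omega>. X i \<omega> /\<^sub>R norm (X t0 \<omega>)))
        = (\<integral>\<omega>. f (vec_of I (\<lambda>i \<omega>. X i \<omega> /\<^sub>R norm (X t0 \<omega>)) \<omega>) \<partial>uniform_measure M (E x))"
      unfolding vec_law_def by (rule integral_distr[OF vX' bounded_continuous_measurable[OF f]])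
    also have "\<dots> = (\<integral>\<omega>. indicator (E x) \<omega> * f (vec_of I (\<lambda>i \<omega>. X i \<omega> /\<^sub>R norm (X t0 \<omega>)) \<omega>) \<partial>M) / prob (E x)"
      by (rule integral_uniform_measure[OF finite_measure_axioms E _ fX]) (use pos in auto)
    finally show "(x * (\<integral>\<omega>. indicator (E x) \<omega> * f (\<lambda>t\<in>I. X t \<omega> /\<^sub>R norm (X t0 \<omega>)) \<partial>M)) / (x * prob (E x))
      = (\<integral>v. f v \<partial>vec_law (uniform_measure M (E x)) I (\<lambda>i \<omega>. X i \<omega> /\<^sub>R norm (X t0 \<omega>)))"
      using pos by (auto simp: vec_of_def zero_less_mult_iff)
  qed
  from Lim_transform_eventually[OF quot this] show ?thesis
    by (simp add: E_def W_def)
qed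

section \<open>The CM3 process as a process of suprema\<close>

text \<open>
  The innovations are indexed by all pairs \<open>(m, j)\<close>; the coefficient of \<open>Z\<^sub>m\<^sup>(\<^sup>j\<^sup>)\<close> in \<open>X\<^sub>t\<close> is \<open>a\<^bsub>t-m\<^esub>\<^sup>(\<^sup>j\<^sup>)\<close>, which is
  zero for future innovations. This makes one family of coefficients serve all times.
\<close>

definition cm3_coeff :: "(nat \<Rightarrow> int \<Rightarrow> 'q::finite cfun) \<Rightarrow> int \<times> int \<Rightarrow> int \<Rightarrow> 'q cfun"
  where "cm3_coeff a n t = extend_zero a (t - fst n) (snd n)"

lemma cm3_coeff_nonneg:
  assumes "\<And>i j y. 0 < apply_bcontfun (a i j) y"
  shows "0 \<le> apply_bcontfun (cm3_coeff a n t) y"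
  using less_imp_le[OF assms] by (simp add: cm3_coeff_def extend_zero_def)

lemma integrable_cm3_coeff:
  assumes "(\<lambda>(j, i). norm (a i j)) summable_on (UNIV :: (int \<times> nat) set)"
  shows "integrable (count_space UNIV) (\<lambda>n. norm (cm3_coeff a n t))"
proof -
  let ?\<phi> = "\<lambda>(j :: int, i). (t - int i, j)"
  have inj: "inj ?\<phi>" by (auto simp: inj_on_def)
  have "((\<lambda>n. norm (cm3_coeff a n t)) \<circ> ?\<phi>) summable_on UNIV"
    using assms by (simp add: comp_def split_beta' cm3_coeff_def extend_zero_def)
  then have "(\<lambda>n. norm (cm3_coeff a n t)) summable_on range ?\<phi>"
    by (simp add: summable_on_reindex[OF inj])
  moreover have "norm (cm3_coeff a n t) = 0" if "n \<notin> range ?\<phi>" for n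
  proof (rule ccontr)
    assume "norm (cm3_coeff a n t) \<noteq> 0"
    then have "fst n \<le> t" by (auto simp: cm3_coeff_def extend_zero_def split: if_splits)
    then have "n = ?\<phi> (snd n, nat (t - fst n))" by (simp add: prod_eq_iff)
    then show False using that by blast
  qed
  ultimately have "(\<lambda>n. norm (cm3_coeff a n t)) summable_on UNIV"
    using summable_on_cong_neutral[of UNIV "range ?\<phi>" "\<lambda>n. norm (cm3_coeff a n t)"] by auto
  then have "Infinite_Set_Sum.abs_summable_on (\<lambda>n. norm (cm3_coeff a n t)) UNIV"
    by (intro abs_summable_equivalent[THEN iffD1]) simp
  then show ?thesis
    by (simp add: Infinite_Set_Sum.abs_summable_on_def)
qed

lemma cm3_sup_eq_SUP_pairs:
  "cm3_sup a Z t \<omega> y = (SUP p. ereal (apply_bcontfun (a (snd p) (fst p)) y * Z (t - int (snd p)) (fst p) \<omega>))"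
  (is "_ = (SUP p. ?f p)")
  unfolding cm3_sup_def
proof (intro antisym SUP_least)
  show "ereal (apply_bcontfun (a i j) y * Z (t - int i) j \<omega>) \<le> (SUP p. ?f p)" for i j
    using SUP_upper[of "(j, i)" UNIV ?f] by simp
  show "?f p \<le> (SUP j. SUP i. ereal (apply_bcontfun (a i j) y * Z (t - int i) j \<omega>))" for p
    by (rule SUP_upper2[of "fst p"], simp, rule SUP_upper2[of "snd p"]) simp_all
qed

lemma cm3_eqI:
  assumes "\<And>y. cm3_sup a Z t \<omega> y = (SUP n. ereal (apply_bcontfun (c n) y * z n))"
  shows "cm3 a Z t \<omega> = max_linear_fun c z"
  unfolding cm3_def max_linear_fun_def max_linear_def assms ..

lemma cm3_eq_max_linear_fun:
  "cm3 a Z t \<omega> = max_linear_fun (\<lambda>p. a (snd p) (fst p)) (\<lambda>p. Z (t - int (snd p)) (fst p) \<omega>)"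
  by (rule cm3_eqI) (rule cm3_sup_eq_SUP_pairs)

lemma borel_measurable_cm3:
  assumes "\<And>i j. Z i j \<in> borel_measurable M"
  shows "cm3 a Z t \<in> borel_measurable M"
  unfolding cm3_eq_max_linear_fun by (rule measurable_max_linear_fun) (rule assms)

text \<open>The additional terms, those of future innovations, are zero and hence below the others.\<close>

lemma cm3_sup_eq_SUP_coeff:
  assumes a: "\<And>i j y. 0 < apply_bcontfun (a i j) y" and Z: "\<And>i j. 0 \<le> Z i j \<omega>"
  shows "cm3_sup a Z t \<omega> y = (SUP n. ereal (apply_bcontfun (cm3_coeff a n t) y * (case n of (m, j) \<Rightarrow> Z m j \<omega>)))"
  unfolding cm3_sup_eq_SUP_pairs
proof (rule SUP_eq)
  fix p :: "int \<times> nat"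
  show "\<exists>n\<in>UNIV. ereal (apply_bcontfun (a (snd p) (fst p)) y * Z (t - int (snd p)) (fst p) \<omega>)
      \<le> ereal (apply_bcontfun (cm3_coeff a n t) y * (case n of (m, j) \<Rightarrow> Z m j \<omega>))"
    by (rule bexI[of _ "(t - int (snd p), fst p)"]) (simp_all add: cm3_coeff_def extend_zero_def)
next
  fix n :: "int \<times> int"
  obtain m j where n: "n = (m, j)" by force
  show "\<exists>p\<in>UNIV. ereal (apply_bcontfun (cm3_coeff a n t) y * (case n of (m, j) \<Rightarrow> Z m j \<omega>))
      \<le> ereal (apply_bcontfun (a (snd p) (fst p)) y * Z (t - int (snd p)) (fst p) \<omega>)"
  proof (cases "t - m < 0")
    case True
    then have "apply_bcontfun (cm3_coeff a n t) y * (case n of (m, j) \<Rightarrow> Z m j \<omega>) = 0"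
      by (simp add: n cm3_coeff_def extend_zero_def)
    moreover have "0 \<le> apply_bcontfun (a 0 0) y * Z t 0 \<omega>"
      using less_imp_le[OF a] Z by simp
    ultimately show ?thesis by (intro bexI[of _ "(0, 0)"]) auto
  next
    case False
    then show ?thesis
      by (intro bexI[of _ "(j, nat (t - m))"]) (simp_all add: n cm3_coeff_def extend_zero_def)
  qed
qed

lemma cm3_eq_max_linear_coeff:
  assumes "\<And>i j y. 0 < apply_bcontfun (a i j) y" and "\<And>i j. 0 \<le> Z i j \<omega>"
  shows "cm3 a Z t \<omega> = max_linear_fun (\<lambda>n. cm3_coeff a n t) (\<lambda>(m, j). Z m j \<omega>)"
  by (rule cm3_eqI) (rule cm3_sup_eq_SUP_coeff[where a=a and Z=Z and \<omega>=\<omega>, OF assms])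

subsection \<open>The law of the path\<close>

text \<open>
  Independence and the unit Frechet margins as one equation between laws, a form that is visibly stable
  under shifts of time.
\<close>

definition innovations_law :: "'w measure \<Rightarrow> (int \<Rightarrow> int \<Rightarrow> 'w \<Rightarrow> real) \<Rightarrow> bool"
  where "innovations_law M Z \<longleftrightarrow> (\<forall>i j. Z i j \<in> borel_measurable M) \<and>
    distr M innovations (\<lambda>\<omega> (i, j). Z i j \<omega>) = innovations"

lemma measurable_into_innovations:
  assumes "\<And>n. (\<lambda>\<omega>. \<zeta> \<omega> n) \<in> borel_measurable M"
  shows "\<zeta> \<in> measurable M innovations"
proof -
  have "\<zeta> \<in> measurable M (PiM UNIV (\<lambda>_. borel))"
    by (rule measurable_PiM_single') (use assms in \<open>auto simp: eta_contract_eq\<close>)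
  then show ?thesis unfolding measurable_cong_sets[OF refl sets_innovations] .
qed

lemma innovations_law_iid_frechet:
  assumes M: "prob_space M" and indep: "prob_space.indep_vars M (\<lambda>_. borel) (\<lambda>(i, j). Z i j) UNIV"
    and Z: "\<And>i j. unit_frechet M (Z i j)"
  shows "innovations_law M Z"
proof -
  interpret prob_space M by fact
  have meas: "Z i j \<in> borel_measurable M" for i j using Z by (simp add: unit_frechet_def)
  let ?\<zeta> = "\<lambda>\<omega> n. (case n of (i, j) \<Rightarrow> Z i j) \<omega>"
  have "distr M (PiM UNIV (\<lambda>_. borel)) (\<lambda>\<omega>. \<lambda>n\<in>UNIV. (case n of (i, j) \<Rightarrow> Z i j) \<omega>)
      = PiM UNIV (\<lambda>n. distr M borel (case n of (i, j) \<Rightarrow> Z i j))"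
    using indep by (subst (asm) indep_vars_iff_distr_eq_PiM) (auto intro: meas)
  also have "(\<lambda>n. distr M borel (case n of (i, j) \<Rightarrow> Z i j)) = (\<lambda>_. frechet_law)"
    using distr_unit_frechet[OF M Z] by (auto simp: fun_eq_iff)
  finally have "distr M (PiM UNIV (\<lambda>_. borel)) ?\<zeta> = innovations"
    by (simp add: innovations_def)
  moreover have "distr M innovations ?\<zeta> = distr M (PiM UNIV (\<lambda>_. borel)) ?\<zeta>"
    by (rule distr_cong) (simp_all add: sets_innovations)
  moreover have "?\<zeta> = (\<lambda>\<omega> (i, j). Z i j \<omega>)" by (auto simp: fun_eq_iff)
  ultimately show ?thesis using meas by (simp add: innovations_law_def)
qed

lemma innovations_law_shift:
  assumes "innovations_law M Z"
  shows "innovations_law M (\<lambda>i. Z (i + h))"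
proof -
  let ?\<sigma> = "\<lambda>(i, j). (i + h, j) :: int \<times> int" and ?\<zeta> = "\<lambda>\<omega> (i, j). Z i j \<omega>"
  have meas: "?\<zeta> \<in> measurable M innovations"
    using assms by (intro measurable_into_innovations) (auto simp: innovations_law_def)
  have shift: "(\<lambda>z n. z (?\<sigma> n)) \<in> measurable innovations innovations"
    by (rule measurable_into_innovations) (rule measurable_coordinate)
  have "distr innovations innovations (\<lambda>z n. z (?\<sigma> n)) = innovations"
    using distr_PiM_reindex[of UNIV "\<lambda>_. frechet_law" ?\<sigma> UNIV] prob_space_frechet_law
    by (simp add: innovations_def inj_on_def split_beta' prod_eq_iff restrict_UNIV)
  moreover have "distr innovations innovations (\<lambda>z n. z (?\<sigma> n)) = distr M innovations (\<lambda>\<omega> n. ?\<zeta> \<omega> (?\<sigma> n))"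
    using assms distr_distr[OF shift meas] by (simp add: innovations_law_def comp_def)
  moreover have "(\<lambda>\<omega> n. ?\<zeta> \<omega> (?\<sigma> n)) = (\<lambda>\<omega> (i, j). Z (i + h) j \<omega>)" by (auto simp: fun_eq_iff)
  ultimately show ?thesis using assms by (simp add: innovations_law_def)
qed

lemma AE_innovations_law:
  assumes law: "innovations_law M Z" and P: "AE z in innovations. P z"
  shows "AE \<omega> in M. P (\<lambda>(i, j). Z i j \<omega>)"
proof -
  have "(\<lambda>\<omega> (i, j). Z i j \<omega>) \<in> measurable M innovations"
    using law by (intro measurable_into_innovations) (auto simp: innovations_law_def)
  moreover have "AE z in distr M innovations (\<lambda>\<omega> (i, j). Z i j \<omega>). P z"
    using law P by (simp only: innovations_law_def)
  ultimately show ?thesis by (rule AE_distrD)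
qed

lemma cm3_path_law:
  assumes a: "\<And>i j y. 0 < apply_bcontfun (a i j) y" and law: "innovations_law M Z"
  shows "distr M borel (\<lambda>\<omega> t. cm3 a Z t \<omega>)
    = distr innovations borel (\<lambda>z t. max_linear_fun (\<lambda>n. cm3_coeff a n t) z)"
proof -
  let ?\<zeta> = "\<lambda>\<omega> (i, j). Z i j \<omega>" and ?Y = "\<lambda>z t. max_linear_fun (\<lambda>n. cm3_coeff a n t) z"
  have Z: "\<And>i j. Z i j \<in> borel_measurable M" using law by (simp add: innovations_law_def)
  have \<zeta>: "?\<zeta> \<in> measurable M innovations"
    using Z by (intro measurable_into_innovations) auto
  have Y: "?Y \<in> borel_measurable innovations"
    by (rule borel_measurable_path) measurable
  have pos: "AE \<omega> in M. \<forall>n. 0 < ?\<zeta> \<omega> n"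
    by (rule AE_innovations_law[OF law AE_innovations_pos])
  have "distr M borel (\<lambda>\<omega> t. cm3 a Z t \<omega>) = distr M borel (\<lambda>\<omega>. ?Y (?\<zeta> \<omega>))"
  proof (rule distr_cong_AE)
    show "AE \<omega> in M. (\<lambda>t. cm3 a Z t \<omega>) = ?Y (?\<zeta> \<omega>)"
      using pos
    proof eventually_elim
      fix \<omega> assume "\<forall>n. 0 < ?\<zeta> \<omega> n"
      then have "0 \<le> Z i j \<omega>" for i j by (auto intro: less_imp_le)
      then show "(\<lambda>t. cm3 a Z t \<omega>) = ?Y (?\<zeta> \<omega>)"
        using cm3_eq_max_linear_coeff[where a=a and Z=Z and \<omega>=\<omega>, OF a] by blast
    qed
  qed (auto intro: borel_measurable_path borel_measurable_cm3 Z measurable_compose[OF \<zeta> Y])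
  also have "\<dots> = distr (distr M innovations ?\<zeta>) borel ?Y"
    by (simp add: distr_distr[OF Y \<zeta>] comp_def)
  also have "\<dots> = distr innovations borel ?Y"
    using law by (simp add: innovations_law_def)
  finally show ?thesis .
qed

lemma AE_cm3_eq_cm3_sup:
  assumes a: "\<And>i j y. 0 < apply_bcontfun (a i j) y" and law: "innovations_law M Z"
    and sum: "(\<lambda>(j, i). norm (a i j)) summable_on (UNIV :: (int \<times> nat) set)"
  shows "AE \<omega> in M. \<forall>y. ereal (apply_bcontfun (cm3 a Z t \<omega>) y) = cm3_sup a Z t \<omega> y"
  using AE_innovations_law[OF law AE_tame[OF integrable_cm3_coeff[OF sum, of t]]]
proof eventually_elim
  fix \<omega> assume tame: "tame (\<lambda>n. cm3_coeff a n t) (\<lambda>(i, j). Z i j \<omega>)"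
  then have Z: "0 \<le> Z i j \<omega>" for i j by (auto simp: tame_def)
  obtain g where g: "max_linear (\<lambda>n. cm3_coeff a n t) (\<lambda>(i, j). Z i j \<omega>) g"
    using ex_max_linear[OF tame] cm3_coeff_nonneg[OF a] by auto
  show "\<forall>y. ereal (apply_bcontfun (cm3 a Z t \<omega>) y) = cm3_sup a Z t \<omega> y"
    using g cm3_sup_eq_SUP_coeff[where a=a and Z=Z and \<omega>=\<omega>, OF a Z] max_linear_fun_eq[OF g] cm3_eq_max_linear_coeff[where a=a and Z=Z and \<omega>=\<omega>, OF a Z]
    by (simp add: max_linear_def)
qed

lemma vec_law_path_law:
  fixes X :: "'t::countable \<Rightarrow> 'w \<Rightarrow> 'b::second_countable_topology"
  assumes "\<And>t. X t \<in> borel_measurable M"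
  shows "vec_law M I X = distr (distr M borel (\<lambda>\<omega> t. X t \<omega>)) (vec_borel I) (\<lambda>v. restrict v I)"
  using distr_distr[OF measurable_restrict_vec[of I] borel_measurable_path[where X=X, OF assms]]
  by (simp add: vec_law_def vec_of_def[abs_def] comp_def)

text \<open>The process at time \<open>t + h\<close> is the same functional of the innovations shifted by \<open>h\<close>.\<close>

lemma stationary_cm3:
  assumes a: "\<And>i j y. 0 < apply_bcontfun (a i j) y" and law: "innovations_law M Z"
  shows "stationary_process M (cm3 a Z)"
  unfolding stationary_process_def
proof (intro conjI allI impI)
  have meas: "cm3 a Z t \<in> borel_measurable M" for t
    using law by (intro borel_measurable_cm3) (simp add: innovations_law_def)
  then show "cm3 a Z t \<in> borel_measurable M" for t .
  fix k l h :: int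
  have shift: "cm3 a Z (t + h) = cm3 a (\<lambda>i. Z (i + h)) t" for t
    by (simp add: fun_eq_iff cm3_eq_max_linear_fun algebra_simps)
  have "distr M borel (\<lambda>\<omega> t. cm3 a Z (t + h) \<omega>) = distr M borel (\<lambda>\<omega> t. cm3 a Z t \<omega>)"
    unfolding shift using cm3_path_law[OF a law] cm3_path_law[OF a innovations_law_shift[OF law]] by simp
  then show "vec_law M {k..l} (\<lambda>t. cm3 a Z (t + h)) = vec_law M {k..l} (cm3 a Z)"
    using meas vec_law_path_law[of "\<lambda>t. cm3 a Z (t + h)" M] vec_law_path_law[of "cm3 a Z" M] by simp
qed

section \<open>The law of the spectral process\<close>

text \<open>
  The random index \<open>(-I, J)\<close> of the innovation that is large at time \<open>0\<close>. Since its probabilities add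
  up to one, the normalising constant is the sum of the weights \<open>\<parallel>c\<^sub>n(0)\<parallel>\<close> over all innovations.
\<close>

lemma integral_random_index:
  fixes a :: "nat \<Rightarrow> int \<Rightarrow> 'q::finite cfun" and F :: "int \<times> int \<Rightarrow> real"
  assumes P: "prob_space P"
    and I: "I \<in> measurable P (count_space UNIV)" and J: "J \<in> measurable P (count_space UNIV)"
    and prob: "\<And>i j. measure P {\<omega> \<in> space P. (I \<omega>, J \<omega>) = (i, j)} = norm (a i j) / W" and W: "0 \<le> W"
  shows "(\<integral>\<omega>. F (- int (I \<omega>), J \<omega>) \<partial>P)
    = (\<integral>n. norm (cm3_coeff a n 0) * F n \<partial>count_space UNIV) / (\<integral>n. norm (cm3_coeff a n 0) \<partial>count_space UNIV)"
proof -
  interpret prob_space P by fact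
  let ?K = "count_space (UNIV :: (int \<times> int) set)" and ?w = "\<lambda>n. norm (cm3_coeff a n 0)"
  define \<xi> where "\<xi> \<omega> = (- int (I \<omega>), J \<omega>)" for \<omega>
  have \<xi>: "\<xi> \<in> measurable P ?K"
  proof -
    have "\<xi> \<in> measurable P (count_space UNIV \<Otimes>\<^sub>M count_space UNIV)"
      unfolding \<xi>_def by (intro measurable_Pair measurable_compose[OF I] J) simp
    then show ?thesis by (simp add: pair_measure_countable)
  qed
  have law: "distr P ?K \<xi> = density ?K (\<lambda>n. ennreal (?w n / W))"
  proof (rule measure_eqI_countable[where A=UNIV])
    fix n :: "int \<times> int"
    obtain m j where n: "n = (m, j)" by force
    have "emeasure (distr P ?K \<xi>) {n} = ennreal (prob {\<omega> \<in> space P. \<xi> \<omega> = n})"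
      using \<xi> by (subst emeasure_distr) (auto simp: emeasure_eq_measure vimage_def Int_def conj_commute)
    also have "prob {\<omega> \<in> space P. \<xi> \<omega> = n} = ?w n / W"
    proof (cases "0 < m")
      case True
      then have empty: "{\<omega> \<in> space P. \<xi> \<omega> = n} = {}" by (auto simp: \<xi>_def n)
      show ?thesis unfolding empty using True by (simp add: cm3_coeff_def extend_zero_def n)
    next
      case False
      then have "{\<omega> \<in> space P. \<xi> \<omega> = n} = {\<omega> \<in> space P. (I \<omega>, J \<omega>) = (nat (- m), j)}"
        by (auto simp: \<xi>_def n)
      then show ?thesis using False prob[of "nat (- m)" j] by (simp add: cm3_coeff_def extend_zero_def n)
    qed
    finally show "emeasure (distr P ?K \<xi>) {n} = emeasure (density ?K (\<lambda>n. ennreal (?w n / W))) {n}"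
      by (subst emeasure_density) auto
  qed auto
  have int: "(\<integral>\<omega>. G (\<xi> \<omega>) \<partial>P) = (\<integral>n. ?w n * G n \<partial>?K) / W" for G :: "int \<times> int \<Rightarrow> real"
  proof -
    have "(\<integral>\<omega>. G (\<xi> \<omega>) \<partial>P) = (\<integral>n. G n \<partial>distr P ?K \<xi>)"
      by (rule integral_distr[OF \<xi>, symmetric]) simp
    also have "\<dots> = (\<integral>n. (?w n / W) *\<^sub>R G n \<partial>?K)"
      unfolding law using W by (intro integral_density) auto
    finally show ?thesis by simp
  qed
  have "W = (\<integral>n. ?w n \<partial>?K)"
    using int[of "\<lambda>_. 1"] prob_space by (auto simp: field_simps split: if_splits)
  then show ?thesis
    using int[of F] by (simp add: \<xi>_def)
qed

theorem theorem2p3: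
  fixes M :: "'w measure" and P :: "'p measure" and N :: "'v measure"
    and a :: "nat \<Rightarrow> int \<Rightarrow> 'q::finite cfun"
    and Z :: "int \<Rightarrow> int \<Rightarrow> 'w \<Rightarrow> real"
    and I :: "'p \<Rightarrow> nat" and J :: "'p \<Rightarrow> int"
  assumes "prob_space M"
    and "prob_space.indep_vars M (\<lambda>_. borel) (\<lambda>(i, j). Z i j) UNIV"
    and "\<And>i j. unit_frechet M (Z i j)"
    and "\<And>i j y. 0 < apply_bcontfun (a i j) y"
    and "(\<lambda>(j, i). norm (a i j)) summable_on UNIV"
    and "prob_space P"
    and "I \<in> measurable P (count_space UNIV)"
    and "J \<in> measurable P (count_space UNIV)"
    and "\<And>i j. measure P {\<omega> \<in> space P. (I \<omega>, J \<omega>) = (i, j)} =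
           norm (a i j) / (\<Sum>\<^sub>\<infinity>l. \<Sum>\<^sub>\<infinity>k. norm (a k l))"
  defines "X \<equiv> cm3 a Z"
    and "A \<equiv> (\<lambda>t \<omega>. extend_zero a (t + int (I \<omega>)) (J \<omega>) /\<^sub>R norm (a (I \<omega>) (J \<omega>)))"
  shows "(\<forall>t. AE \<omega> in M. \<forall>y. ereal (apply_bcontfun (X t \<omega>) y) = cm3_sup a Z t \<omega> y) \<and>
    jointly_regularly_varying M X 1 \<and>
    spectral_process M X P A \<and>
    (\<forall>\<Theta>. spectral_process M X N \<Theta> \<longrightarrow>
      (\<forall>s t. 0 \<le> s \<longrightarrow> 0 \<le> t \<longrightarrow> vec_law N {-s..t} \<Theta> = vec_law P {-s..t} A))"
proof -
  note a = assms(4) and sum = assms(5)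
  interpret P: prob_space P by (rule assms(6))
  define c where "c = cm3_coeff a"
  have c: "0 \<le> apply_bcontfun (c n t) y" for n t y
    unfolding c_def by (rule cm3_coeff_nonneg[OF a])
  have int_c: "integrable (count_space UNIV) (\<lambda>n. norm (c n t))" for t
    unfolding c_def by (rule integrable_cm3_coeff[OF sum])
  have c_present: "c (t, j) t \<noteq> 0" for t j
  proof
    assume "c (t, j) t = 0"
    then have "apply_bcontfun (a 0 j) undefined = 0"
      by (simp add: c_def cm3_coeff_def extend_zero_def)
    then show False using a[of 0 j undefined] by simp
  qed
  have law: "innovations_law M Z"
    by (rule innovations_law_iid_frechet[OF assms(1-3)])
  have X: "X t \<in> borel_measurable M" for t
    unfolding X_def using law by (intro borel_measurable_cm3) (simp add: innovations_law_def)
  have X_law: "distr M borel (\<lambda>\<omega> t. X t \<omega>) = distr innovations borel (\<lambda>z t. max_linear_fun (\<lambda>n. c n t) z)"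
    unfolding X_def c_def by (rule cm3_path_law[OF a law])
  have jointly: "jointly_regularly_varying M X 1"
    unfolding jointly_regularly_varying_def
  proof (intro conjI allI impI)
    show "stationary_process M X"
      unfolding X_def by (rule stationary_cm3[OF a law])
    show "regularly_varying_vec M {k..l} X 1" if "k \<le> l" for k l
      by (rule regularly_varying_max_linear[OF X X_law c int_c, where ?t0.0=k and ?n0.0="(k, 0)"])
        (use that c_present in auto)
  qed
  have A_eq: "A t \<omega> = c (- int (I \<omega>), J \<omega>) t /\<^sub>R norm (c (- int (I \<omega>), J \<omega>) 0)" for t \<omega>
    by (simp add: A_def c_def cm3_coeff_def extend_zero_def)
  have A: "A t \<in> borel_measurable P" for t
  proof -
    have "(\<lambda>\<omega>. (I \<omega>, J \<omega>)) \<in> measurable P (count_space UNIV \<Otimes>\<^sub>M count_space UNIV)"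
      using assms(7,8) by (rule measurable_Pair)
    then have "(\<lambda>\<omega>. (I \<omega>, J \<omega>)) \<in> measurable P (count_space UNIV)"
      by (simp add: pair_measure_countable)
    from measurable_compose[OF this, of "\<lambda>(i, j). extend_zero a (t + int i) j /\<^sub>R norm (a i j)" borel]
    show ?thesis by (simp add: A_def)
  qed
  have A_nonneg: "0 \<le> apply_bcontfun (A t \<omega>) y" for t \<omega> y
    unfolding A_eq using c by simp
  have W: "0 \<le> (\<Sum>\<^sub>\<infinity>l. \<Sum>\<^sub>\<infinity>k. norm (a k l))"
    by (intro infsum_nonneg) auto
  have A_integral: "(\<integral>v. f v \<partial>vec_law P K A)
      = (\<integral>n. norm (c n 0) * f (\<lambda>t\<in>K. c n t /\<^sub>R norm (c n 0)) \<partial>count_space UNIV)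
        / (\<integral>n. norm (c n 0) \<partial>count_space UNIV)" if f: "bounded_continuous K f" for K f
  proof -
    have "(\<integral>v. f v \<partial>vec_law P K A) = (\<integral>\<omega>. f (vec_of K A \<omega>) \<partial>P)"
      unfolding vec_law_def
      by (rule integral_distr[OF measurable_vec_of[OF A] bounded_continuous_measurable[OF f]])
    also have "\<dots> = (\<integral>\<omega>. (\<lambda>n. f (\<lambda>t\<in>K. c n t /\<^sub>R norm (c n 0))) (- int (I \<omega>), J \<omega>) \<partial>P)"
      by (simp add: vec_of_def A_eq)
    also have "\<dots> = (\<integral>n. norm (c n 0) * f (\<lambda>t\<in>K. c n t /\<^sub>R norm (c n 0)) \<partial>count_space UNIV)
        / (\<integral>n. norm (c n 0) \<partial>count_space UNIV)"
      unfolding c_def by (rule integral_random_index[OF assms(6-9) W])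
    finally show ?thesis .
  qed
  have spectral_limit: "((\<lambda>x. \<integral>v. f v \<partial>vec_law (uniform_measure M {\<omega> \<in> space M. norm (X 0 \<omega>) \<ge> x}) K
               (\<lambda>i \<omega>. X i \<omega> /\<^sub>R norm (X 0 \<omega>))) \<longlongrightarrow> (\<integral>v. f v \<partial>vec_law P K A)) at_top"
    if f: "bounded_continuous K f" for K f
    unfolding A_integral[OF f]
    by (rule spectral_limit_max_linear[OF assms(1) X X_law c int_c c_present f])
  have spectral: "spectral_process M X P A"
    unfolding spectral_process_def weakly_converges_def
    using assms(6) A A_nonneg spectral_limit by auto
  \<comment> \<open>The limits of the conditional expectations determine all integrals of bounded continuous functions.\<close>
  have unique: "vec_law N {-s..t} \<Theta> = vec_law P {-s..t} A"
    if \<Theta>: "spectral_process M X N \<Theta>" and "0 \<le> s" "0 \<le> t" for \<Theta> s t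
  proof (rule vec_measure_eq_if_integrals_eq)
    have N: "prob_space N" "\<And>t. \<Theta> t \<in> borel_measurable N"
      using \<Theta> by (auto simp: spectral_process_def)
    show "prob_space (vec_law N {-s..t} \<Theta>)" "prob_space (vec_law P {-s..t} A)"
      unfolding vec_law_def
      by (rule prob_space.prob_space_distr[OF N(1) measurable_vec_of[OF N(2)]],
          rule P.prob_space_distr[OF measurable_vec_of[OF A]])
    fix f :: "(int \<Rightarrow> 'q cfun) \<Rightarrow> real" assume f: "bounded_continuous {-s..t} f"
    have "((\<lambda>x. \<integral>v. f v \<partial>vec_law (uniform_measure M {\<omega> \<in> space M. norm (X 0 \<omega>) \<ge> x}) {-s..t}
               (\<lambda>i \<omega>. X i \<omega> /\<^sub>R norm (X 0 \<omega>))) \<longlongrightarrow> (\<integral>v. f v \<partial>vec_law N {-s..t} \<Theta>)) at_top"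
      using \<Theta> that f unfolding spectral_process_def weakly_converges_def by blast
    then show "(\<integral>v. f v \<partial>vec_law N {-s..t} \<Theta>) = (\<integral>v. f v \<partial>vec_law P {-s..t} A)"
      using tendsto_unique[OF trivial_limit_at_top_linorder _ spectral_limit[OF f]] by blast
  qed (simp_all add: vec_law_def)
  show ?thesis
    using AE_cm3_eq_cm3_sup[OF a law sum] jointly spectral unique unfolding X_def by blast
qed

end
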